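(* Let $S_1, \ldots, S_{K} \subset [0,1)$ be finite unions of intervals with rational endpoints. Then there exist pairwise disjoint sets $\Lambda_1, \ldots, \Lambda_{K} \subset \mathbb{Z}$ such that \[ \bigcup_{k=1}^{K} \mathcal{E}(S_k, \Lambda_k)=\bigcup_{k=1}^{K}\big\{ e^{2\pi i \lambda (\cdot)}\chi_{S_k} : \lambda\in \Lambda_k\big\} \] is a Riesz basis for $L^2\big( \bigcup_{k=1}^{K} S_k \big)$. In particular, if $\bigcup_{k=1}^{K} S_k = [0,1)$, then $\Lambda_1, \ldots, \Lambda_{K}$ form a partition of $\mathbb{Z}$ (that is, in this case such pairwise disjoint sets exist with $\bigcup_{k=1}^K \Lambda_k = \mathbb{Z}$).
   Context: For a measurable set $S \subset \mathbb{R}$ and a discrete set $\Lambda \subset \mathbb{R}$, $\mathcal{E}(S,\Lambda) := \{ e^{2\pi i \lambda (\cdot)} \chi_{S} : \lambda \in \Lambda \}$, where $\chi_S$ is the characteristic function of $S$. Such systems (and their unions) are regarded as families indexed by the frequencies $\lambda$. The sets $\Lambda_k$ are allowed to be empty, also when speaking of a partition. A Riesz basis for a separable Hilbert space $\mathcal{H}$ is a sequence of the form $\{U e_n\}$, where $\{e_n\}$ is an orthonormal basis for $\mathcal{H}$ and $U:\mathcal{H}\to\mathcal{H}$ is a bijective bounded operator; equivalently, it is a complete sequence $\{f_n\}$ in $\mathcal{H}$ for which there are constants $0<A\le B<\infty$ with $A\|c\|_{\ell_2}^2 \le \|\sum_n c_n f_n\|^2 \le B\|c\|_{\ell_2}^2$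 for all $c=\{c_n\}\in\ell_2$. *)

theory Defs
  imports "HOL-Analysis.Analysis"
begin

text \<open>Finite unions of bounded intervals with rational endpoints. Open, closed and half-open
  intervals are all admitted, as are degenerate ones and the empty union.\<close>

definition rational_interval :: "real set \<Rightarrow> bool" where
  "rational_interval J \<longleftrightarrow>
     (\<exists>a\<in>\<rat>. \<exists>b\<in>\<rat>. J = {a..b} \<or> J = {a..<b} \<or> J = {a<..b} \<or> J = {a<..<b})"

definition finite_union_rational_intervals :: "real set \<Rightarrow> bool" where
  "finite_union_rational_intervals S \<longleftrightarrow>
     (\<exists>\<J>. finite \<J> \<and> (\<forall>J\<in>\<J>. rational_interval J) \<and> S = \<Union>\<J>)"

text \<open>The complex Hilbert space \<open>L\<^sup>2(S)\<close> is represented by its square-integrable functions;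
  equality in \<open>L\<^sup>2(S)\<close> is \<open>ae_eq S\<close>, and values outside \<open>S\<close> are irrelevant.\<close>

definition L2 :: "real set \<Rightarrow> (real \<Rightarrow> complex) set" where
  "L2 S = {f \<in> borel_measurable (lebesgue_on S). integrable (lebesgue_on S) (\<lambda>x. (norm (f x))\<^sup>2)}"

definition ae_eq :: "real set \<Rightarrow> (real \<Rightarrow> complex) \<Rightarrow> (real \<Rightarrow> complex) \<Rightarrow> bool" where
  "ae_eq S f g \<longleftrightarrow> (AE x in lebesgue_on S. f x = g x)"

definition L2_inner :: "real set \<Rightarrow> (real \<Rightarrow> complex) \<Rightarrow> (real \<Rightarrow> complex) \<Rightarrow> complex" where
  "L2_inner S f g = (\<integral>x. f x * cnj (g x) \<partial>(lebesgue_on S))"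

definition L2_norm :: "real set \<Rightarrow> (real \<Rightarrow> complex) \<Rightarrow> real" where
  "L2_norm S f = sqrt (\<integral>x. (norm (f x))\<^sup>2 \<partial>(lebesgue_on S))"

definition L2_complete :: "real set \<Rightarrow> 'i set \<Rightarrow> ('i \<Rightarrow> real \<Rightarrow> complex) \<Rightarrow> bool" where
  "L2_complete S I f \<longleftrightarrow>
     (\<forall>g\<in>L2 S. \<forall>\<epsilon>>0. \<exists>F c. finite F \<and> F \<subseteq> I \<and>
        L2_norm S (\<lambda>x. g x - (\<Sum>i\<in>F. c i * f i x)) < \<epsilon>)"

definition L2_orthonormal_basis :: "real set \<Rightarrow> 'i set \<Rightarrow> ('i \<Rightarrow> real \<Rightarrow> complex) \<Rightarrow> bool" where
  "L2_orthonormal_basis S I e \<longleftrightarrow>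
     (\<forall>i\<in>I. e i \<in> L2 S) \<and>
     (\<forall>i\<in>I. \<forall>j\<in>I. L2_inner S (e i) (e j) = (if i = j then 1 else 0)) \<and>
     L2_complete S I e"

text \<open>A bounded complex-linear operator on \<open>L\<^sup>2(S)\<close>, given on representatives. Compatibility
  with \<open>ae_eq S\<close> is not a separate clause: it follows from linearity and boundedness.\<close>

definition L2_bounded_operator ::
    "real set \<Rightarrow> ((real \<Rightarrow> complex) \<Rightarrow> (real \<Rightarrow> complex)) \<Rightarrow> bool" where
  "L2_bounded_operator S U \<longleftrightarrow>
     (\<forall>f\<in>L2 S. U f \<in> L2 S) \<and>
     (\<forall>f\<in>L2 S. \<forall>g\<in>L2 S. ae_eq S (U (\<lambda>x. f x + g x)) (\<lambda>x. U f x + U g x)) \<and>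
     (\<forall>a. \<forall>f\<in>L2 S. ae_eq S (U (\<lambda>x. a * f x)) (\<lambda>x. a * U f x)) \<and>
     (\<exists>C. \<forall>f\<in>L2 S. L2_norm S (U f) \<le> C * L2_norm S f)"

definition L2_bijective ::
    "real set \<Rightarrow> ((real \<Rightarrow> complex) \<Rightarrow> (real \<Rightarrow> complex)) \<Rightarrow> bool" where
  "L2_bijective S U \<longleftrightarrow>
     (\<forall>f\<in>L2 S. \<forall>g\<in>L2 S. ae_eq S (U f) (U g) \<longrightarrow> ae_eq S f g) \<and>
     (\<forall>g\<in>L2 S. \<exists>f\<in>L2 S. ae_eq S (U f) g)"

text \<open>The index set is part of the notion, so a repeated function counts as often as it is
  indexed. For a null set \<open>S\<close> the space is trivial and only \<open>I = {}\<close> qualifies.\<close>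

definition L2_riesz_basis :: "real set \<Rightarrow> 'i set \<Rightarrow> ('i \<Rightarrow> real \<Rightarrow> complex) \<Rightarrow> bool" where
  "L2_riesz_basis S I f \<longleftrightarrow>
     (\<exists>e U. L2_orthonormal_basis S I e \<and> L2_bounded_operator S U \<and> L2_bijective S U \<and>
        (\<forall>i\<in>I. ae_eq S (f i) (U (e i))))"

definition windowed_exp :: "real set \<Rightarrow> real \<Rightarrow> real \<Rightarrow> complex" where
  "windowed_exp S \<xi> x = exp (2 * of_real pi * \<i> * of_real \<xi> * of_real x) * indicator S x"

end

(* Let N be a common denominator of all end points, so that on [0,1) every S_k is, up to finitely
   many points, a union of cells (n/N, (n+1)/N). Take each Lambda_k to be a union of residue classes
   r + N Z. In the coordinate y = x - n/N of the cells, exp(2 pi i (r + N j) x) splits into the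
   factor exp(2 pi i N j x), which runs through an orthogonal basis on each cell, the unimodular
   factor exp(2 pi i r y), and the root of unity w^(rn). Hence the system is a Riesz basis as soon as
   the finite matrix with entries w^(rn) [cell n inside S_(k(r))] is square and invertible. A choice
   r |-> k(r) with this property exists because the matrix D_n w^(rn), D_n being the number of the
   sets containing cell n, is invertible and its columns are the sums over k of the candidate
   columns: by multilinearity of the determinant some choice of summands is invertible. *)

theory Submission
  imports Defs
begin

text \<open>The candidate columns sum to an invertible matrix only if every one of the N cells lies
  in some set. When the union is smaller than [0,1), its complement therefore joins as a further set
  with label 0; the residues that receive this label are discarded, and what remains is an
  invertible block between the cells of the union and the kept residues. Invertibility is carried as
  an explicit inverse rather than as a nonzero determinant, because the entries of the inverse,
  twisted by phases, are the entries of the inverse operator. An invertible block is square, so kept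
  residues r can be matched with cells by any bijection \<sigma>. The operator of the Riesz basis
  combines the values of a function at points with equal coordinate y, and carries sqrt N exp(2 pi i
  N j x), supported on the cell \<sigma> r, to the windowed exponential of frequency r + N j.
  Squareness also yields the partition: if all N cells occur, no residue can be discarded. The
  analytic core is completeness of these exponentials on the cells, obtained by truncation,
  dominated convergence and uniform approximation on the circle.\<close>

section \<open>Finite linear algebra: inverse pairs and an invertible Fourier block\<close>

text \<open>Cells and residues are different index sets and nothing says beforehand that they are
  equinumerous, so both products are prescribed.\<close>

definition mutually_inverse ::
    "'a set \<Rightarrow> 'b set \<Rightarrow> ('a \<Rightarrow> 'b \<Rightarrow> 'c::field) \<Rightarrow> ('b \<Rightarrow> 'a \<Rightarrow> 'c) \<Rightarrow> bool" where
  "mutually_inverse X Y M B \<longleftrightarrow>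
     (\<forall>n\<in>X. \<forall>m\<in>X. (\<Sum>r\<in>Y. M n r * B r m) = of_bool (n = m)) \<and>
     (\<forall>r\<in>Y. \<forall>s\<in>Y. (\<Sum>n\<in>X. B r n * M n s) = of_bool (r = s))"

text \<open>One Gauss-Jordan pivot step: \<open>\<alpha>\<close> = B v holds the coordinates of
  \<open>v\<close> in the columns of \<open>M\<close>, and \<open>v\<close> may replace column
  \<open>r0\<close> when the pivot \<open>\<alpha> r0\<close> is nonzero. \<open>B'\<close> is
  \<open>B\<close> after the corresponding row elimination.\<close>

lemma mutually_inverse_replace_column:
  assumes "finite Y" and M: "mutually_inverse X Y M B" and r0: "r0 \<in> Y"
    and nz: "(\<Sum>n\<in>X. B r0 n * v n) \<noteq> 0"
  shows "\<exists>B'. mutually_inverse X Y (\<lambda>n r. if r = r0 then v n else M n r) B'"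
proof -
  define \<alpha> where "\<alpha> r = (\<Sum>n\<in>X. B r n * v n)" for r
  define B' where "B' r n = (if r = r0 then B r0 n / \<alpha> r0
      else B r n - \<alpha> r / \<alpha> r0 * B r0 n)" for r n
  have a0: "\<alpha> r0 \<noteq> 0" using nz by (simp add: \<alpha>_def)
  have MB: "(\<Sum>r\<in>Y. M n r * B r m) = of_bool (n = m)" if "n \<in> X" "m \<in> X" for n m
    using M that by (simp add: mutually_inverse_def)
  have BM: "(\<Sum>n\<in>X. B r n * M n s) = of_bool (r = s)" if "r \<in> Y" "s \<in> Y" for r s
    using M that by (simp add: mutually_inverse_def)
  have M\<alpha>: "(\<Sum>r\<in>Y. M n r * \<alpha> r) = v n" if n: "n \<in> X" for n
  proof (cases "finite X")
    case True
    have "(\<Sum>r\<in>Y. M n r * \<alpha> r) = (\<Sum>m\<in>X. (\<Sum>r\<in>Y. M n r * B r m) * v m)"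
      unfolding \<alpha>_def sum_distrib_left sum_distrib_right
      by (subst sum.swap) (simp add: mult.assoc)
    also have "\<dots> = (\<Sum>m\<in>X. if n = m then v m else 0)"
      by (intro sum.cong refl) (simp add: MB n)
    finally show ?thesis using True n by simp
  next
    \<comment> \<open>A sum over an infinite set is 0, which contradicts \<open>nz\<close>.\<close>
    case False
    then show ?thesis using nz by simp
  qed
  have "(\<Sum>r\<in>Y. (if r = r0 then v n else M n r) * B' r m) = of_bool (n = m)"
    if n: "n \<in> X" and m: "m \<in> X" for n m
  proof -
    have "(\<Sum>r\<in>Y. (if r = r0 then v n else M n r) * B' r m)
        = v n * B r0 m / \<alpha> r0 + (\<Sum>r\<in>Y-{r0}. M n r * B r m - M n r * \<alpha> r * (B r0 m / \<alpha> r0))"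
      by (subst sum.remove[OF \<open>finite Y\<close> r0])
         (rule arg_cong2[where f = "(+)"], simp add: B'_def,
          rule sum.cong, auto simp: B'_def right_diff_distrib)
    also have "\<dots> = v n * B r0 m / \<alpha> r0
        + ((\<Sum>r\<in>Y-{r0}. M n r * B r m) - (\<Sum>r\<in>Y-{r0}. M n r * \<alpha> r) * (B r0 m / \<alpha> r0))"
      by (simp only: sum_subtractf sum_distrib_right)
    also have "(\<Sum>r\<in>Y-{r0}. M n r * B r m) = of_bool (n = m) - M n r0 * B r0 m"
      using sum.remove[OF \<open>finite Y\<close> r0, of "\<lambda>r. M n r * B r m"] MB[OF n m] by (simp add: algebra_simps)
    also have "(\<Sum>r\<in>Y-{r0}. M n r * \<alpha> r) = v n - M n r0 * \<alpha> r0"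
      using sum.remove[OF \<open>finite Y\<close> r0, of "\<lambda>r. M n r * \<alpha> r"] M\<alpha>[OF n] by (simp add: algebra_simps)
    finally show ?thesis using a0 by (simp add: field_simps)
  qed
  moreover have "(\<Sum>n\<in>X. B' r n * (if s = r0 then v n else M n s)) = of_bool (r = s)"
    if r: "r \<in> Y" and s: "s \<in> Y" for r s
  proof -
    define w where "w n = (if s = r0 then v n else M n s)" for n
    have B'w: "(\<Sum>n\<in>X. B' r n * w n) = (if r = r0 then (\<Sum>n\<in>X. B r0 n * w n) / \<alpha> r0
        else (\<Sum>n\<in>X. B r n * w n) - \<alpha> r / \<alpha> r0 * (\<Sum>n\<in>X. B r0 n * w n))"
      by (simp add: B'_def sum_divide_distrib sum_distrib_left sum_subtractf left_diff_distrib mult.assoc)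
    show ?thesis
    proof (cases "s = r0")
      case True
      then have "(\<Sum>n\<in>X. B t n * w n) = \<alpha> t" for t by (simp add: w_def \<alpha>_def)
      with B'w a0 True show ?thesis by (simp add: w_def)
    next
      case False
      then have "(\<Sum>n\<in>X. B t n * w n) = of_bool (t = s)" if "t \<in> Y" for t
        using BM[OF that s] by (simp add: w_def)
      with B'w False r r0 show ?thesis by (auto simp: w_def)
    qed
  qed
  ultimately have "mutually_inverse X Y (\<lambda>n r. if r = r0 then v n else M n r) B'"
    unfolding mutually_inverse_def by blast
  then show ?thesis by blast
qed

text \<open>Multilinearity of the determinant, in the form of a column-by-column exchange: since
  \<open>B M = 1\<close>, at least one of the summands of a column does not annihilate the matching row
  of the current inverse.\<close>

lemma mutually_inverse_choose_columns:
  assumes "finite Y" and M: "mutually_inverse X Y M B"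
    and cols: "\<And>n r. n \<in> X \<Longrightarrow> r \<in> Y \<Longrightarrow> M n r = (\<Sum>k\<in>K. v k r n)"
  shows "\<exists>\<kappa> B'. (\<forall>r\<in>Y. \<kappa> r \<in> K) \<and> mutually_inverse X Y (\<lambda>n r. v (\<kappa> r) r n) B'"
proof -
  have "\<exists>\<kappa> B'. (\<forall>r\<in>Z. \<kappa> r \<in> K) \<and>
      mutually_inverse X Y (\<lambda>n r. if r \<in> Z then v (\<kappa> r) r n else M n r) B'"
    if "finite Z" "Z \<subseteq> Y" for Z
    using that
  proof (induction Z rule: finite_induct)
    case empty
    then show ?case using M by auto
  next
    case (insert r0 Z)
    then obtain \<kappa> B' where \<kappa>: "\<forall>r\<in>Z. \<kappa> r \<in> K"
      and inv: "mutually_inverse X Y (\<lambda>n r. if r \<in> Z then v (\<kappa> r) r n else M n r) B'"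
      by auto
    have r0: "r0 \<in> Y" "r0 \<notin> Z" using insert by auto
    have "(\<Sum>n\<in>X. B' r0 n * M n r0) = 1"
    proof -
      have "\<forall>s\<in>Y. (\<Sum>n\<in>X. B' r0 n * (if s \<in> Z then v (\<kappa> s) s n else M n s)) = of_bool (r0 = s)"
        using inv r0(1) unfolding mutually_inverse_def by blast
      from bspec[OF this r0(1)] r0(2) show ?thesis by simp
    qed
    moreover have "(\<Sum>n\<in>X. B' r0 n * M n r0) = (\<Sum>k\<in>K. \<Sum>n\<in>X. B' r0 n * v k r0 n)"
      by (subst sum.swap) (simp add: cols r0 sum_distrib_left)
    ultimately obtain k where k: "k \<in> K" "(\<Sum>n\<in>X. B' r0 n * v k r0 n) \<noteq> 0"
      by (metis (no_types, lifting) sum.neutral zero_neq_one)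
    obtain B'' where B'': "mutually_inverse X Y
        (\<lambda>n r. if r = r0 then v k r0 n else if r \<in> Z then v (\<kappa> r) r n else M n r) B''"
      using mutually_inverse_replace_column[OF \<open>finite Y\<close> inv r0(1) k(2)] by blast
    have "(\<lambda>n r. if r = r0 then v k r0 n else if r \<in> Z then v (\<kappa> r) r n else M n r)
        = (\<lambda>n r. if r \<in> insert r0 Z then v ((\<kappa>(r0 := k)) r) r n else M n r)"
      using r0 by (auto simp: fun_eq_iff)
    with B'' \<kappa> k(1) show ?case
      by (intro exI[of _ "\<kappa>(r0 := k)"] exI[of _ B'']) auto
  qed
  from this[OF \<open>finite Y\<close> order_refl] obtain \<kappa> B' where
    \<kappa>: "\<forall>r\<in>Y. \<kappa> r \<in> K" and
    inv: "mutually_inverse X Y (\<lambda>n r. if r \<in> Y then v (\<kappa> r) r n else M n r) B'"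
    by blast
  have "mutually_inverse X Y (\<lambda>n r. v (\<kappa> r) r n) B'"
    using inv unfolding mutually_inverse_def by (simp cong: sum.cong)
  with \<kappa> show ?thesis by blast
qed

text \<open>The products M B and B M have the same trace; characteristic 0 turns this into an
  equality of cardinalities.\<close>

lemma mutually_inverse_card_eq:
  fixes M :: "'a \<Rightarrow> 'b \<Rightarrow> 'c::field_char_0"
  assumes "mutually_inverse X Y M B"
  shows "card X = card Y"
proof -
  have "of_nat (card X) = (\<Sum>n\<in>X. \<Sum>r\<in>Y. M n r * B r n)"
    using assms by (simp add: mutually_inverse_def)
  also have "\<dots> = (\<Sum>r\<in>Y. \<Sum>n\<in>X. B r n * M n r)"
    by (subst sum.swap) (simp add: mult.commute)
  also have "\<dots> = of_nat (card Y)"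
    using assms by (simp add: mutually_inverse_def)
  finally show ?thesis by (simp only: of_nat_eq_iff)
qed

text \<open>For \<open>n \<noteq> m\<close> this is a geometric sum whose ratio is an N-th root of
  unity other than 1.\<close>

lemma sum_roots_of_unity:
  fixes N :: nat
  defines "z \<equiv> \<lambda>k. cis (2 * pi * real k / real N)"
  assumes "n < N" "m < N"
  shows "(\<Sum>r<N. z n ^ r * inverse (z m) ^ r) = of_nat N * of_bool (n = m)"
proof (cases "n = m")
  case True
  then show ?thesis by (simp add: z_def cis_mult flip: power_mult_distrib)
next
  case False
  have bij: "bij_betw z {..<N} {w. w ^ N = 1}"
    unfolding z_def by (rule Complex.bij_betw_roots_unity) (use assms in simp)
  have "z n ^ N = 1" "z m ^ N = 1"
    using bij_betwE[OF bij] assms by auto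
  moreover have "z n \<noteq> z m"
    using bij_betw_imp_inj_on[OF bij] False assms by (auto dest: inj_onD)
  moreover have "z m \<noteq> 0" by (simp add: z_def)
  ultimately have "z n * inverse (z m) \<noteq> 1" "(z n * inverse (z m)) ^ N = 1"
    by (auto simp: field_simps power_mult_distrib)
  then show ?thesis using False by (simp add: geometric_sum flip: power_mult_distrib)
qed

text \<open>Symmetry of the Fourier matrix; it lets \<open>sum_roots_of_unity\<close> serve for the
  sums over cells as well as for those over residues.\<close>

lemma root_of_unity_power_swap:
  "cis (2 * pi * real a / real N) ^ b = cis (2 * pi * real b / real N) ^ a"
  unfolding Complex.DeMoivre by (rule arg_cong[where f = cis]) simp

text \<open>The complement of \<open>\<Union>k\<in>{1..K}. A k\<close> is added as an auxiliary class \<open>0\<close>, so that the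
  supports cover all of \<open>{..<N}\<close>. The resulting square matrix is block diagonal, and its block
  belonging to the classes \<open>1..K\<close> is the desired one.\<close>

lemma exists_invertible_fourier_block:
  fixes A :: "nat \<Rightarrow> nat set" and N K :: nat
  defines "z \<equiv> \<lambda>k. cis (2 * pi * real k / real N)"
  assumes A: "\<And>k. k \<in> {1..K} \<Longrightarrow> A k \<subseteq> {..<N}"
  obtains \<kappa> :: "nat \<Rightarrow> nat" and B where "\<And>r. r < N \<Longrightarrow> \<kappa> r \<le> K"
    and "mutually_inverse (\<Union>k\<in>{1..K}. A k) {r. r < N \<and> \<kappa> r \<noteq> 0}
           (\<lambda>n r. of_bool (n \<in> A (\<kappa> r)) * z n ^ r) B"
proof -
  define X where "X = (\<Union>k\<in>{1..K}. A k)"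
  define A' where "A' k = (if k = 0 then {..<N} - X else A k)" for k
  define D where "D n = card {k\<in>{0..K}. n \<in> A' k}" for n
  define v where "v k r n = of_bool (n \<in> A' k) * z n ^ r" for k r n
  have X: "X \<subseteq> {..<N}" unfolding X_def using A by blast
  have D: "D n \<noteq> 0" if "n < N" for n
  proof -
    have "\<exists>k\<in>{0..K}. n \<in> A' k"
    proof (cases "n \<in> X")
      case True
      then obtain k where "k \<in> {1..K}" "n \<in> A k" by (auto simp: X_def)
      then show ?thesis by (intro bexI[of _ k]) (auto simp: A'_def)
    next
      case False
      then show ?thesis using that by (intro bexI[of _ 0]) (auto simp: A'_def)
    qed
    then show ?thesis by (auto simp: D_def)
  qed
  \<comment> \<open>Adding the candidate columns of all classes counts the entry of cell
    \<open>n\<close> once for each class containing it, which is where the weight \<open>D n\<close>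
    comes from.\<close>
  have vD: "of_nat (D n) * z n ^ r = (\<Sum>k\<in>{0..K}. v k r n)" for n r
    by (simp add: v_def D_def Int_def flip: sum_distrib_right)
  define M where "M n r = of_nat (D n) * z n ^ r" for n r
  define B where "B r n = inverse (z n) ^ r / (of_nat N * of_nat (D n))" for r n
  have "(\<Sum>r<N. M n r * B r m) = of_bool (n = m)" if "n < N" "m < N" for n m
  proof -
    have "(\<Sum>r<N. M n r * B r m)
        = of_nat (D n) / (of_nat N * of_nat (D m)) * (\<Sum>r<N. z n ^ r * inverse (z m) ^ r)"
      by (simp add: M_def B_def sum_distrib_left field_simps)
    also have "(\<Sum>r<N. z n ^ r * inverse (z m) ^ r) = of_nat N * of_bool (n = m)"
      unfolding z_def using that by (rule sum_roots_of_unity)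
    finally show ?thesis using D[OF that(1)] that by auto
  qed
  moreover have "(\<Sum>n<N. B r n * M n s) = of_bool (r = s)" if "r < N" "s < N" for r s
  proof -
    have "(\<Sum>n<N. B r n * M n s) = (\<Sum>n<N. z s ^ n * inverse (z r) ^ n) / of_nat N"
    proof (subst sum_divide_distrib, intro sum.cong refl)
      fix n assume n: "n \<in> {..<N}"
      have "z s ^ n = z n ^ s" "inverse (z r) ^ n = inverse (z n) ^ r"
        unfolding z_def power_inverse by (simp_all only: root_of_unity_power_swap)
      then show "B r n * M n s = z s ^ n * inverse (z r) ^ n / of_nat N"
        using D[of n] n by (simp add: B_def M_def)
    qed
    also have "(\<Sum>n<N. z s ^ n * inverse (z r) ^ n) = of_nat N * of_bool (s = r)"
      unfolding z_def using that by (intro sum_roots_of_unity)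
    finally show ?thesis using that by auto
  qed
  ultimately have "mutually_inverse {..<N} {..<N} M B"
    by (simp add: mutually_inverse_def)
  then obtain \<kappa> C where \<kappa>: "\<forall>r\<in>{..<N}. \<kappa> r \<in> {0..K}"
    and C: "mutually_inverse {..<N} {..<N} (\<lambda>n r. v (\<kappa> r) r n) C"
    using mutually_inverse_choose_columns[of "{..<N}" "{..<N}" M B v "{0..K}"]
    by (auto simp: M_def vD)
  define R where "R = {r. r < N \<and> \<kappa> r \<noteq> 0}"
  have R: "R \<subseteq> {..<N}" by (auto simp: R_def)
  \<comment> \<open>Columns of class 0 vanish on \<open>X\<close>, those of the other classes vanish
    off \<open>X\<close>. Hence the sums over \<open>R\<close> and over \<open>X\<close> equal the
    full sums, and the same \<open>C\<close> inverts the block.\<close>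
  have v0: "v (\<kappa> r) r n = 0" if "n \<in> X" "r < N" "r \<notin> R" for n r
    using that by (auto simp: v_def A'_def R_def)
  have v1: "v (\<kappa> r) r n = 0" if "n < N" "n \<notin> X" "r \<in> R" for n r
  proof -
    have "\<kappa> r \<in> {1..K}" using \<kappa> that by (auto simp: R_def)
    then show ?thesis using that by (auto simp: v_def A'_def R_def X_def)
  qed
  have "(\<Sum>r\<in>R. v (\<kappa> r) r n * C r m) = (\<Sum>r<N. v (\<kappa> r) r n * C r m)" if "n \<in> X" for n m
    using that R by (intro sum.mono_neutral_left) (auto simp: v0)
  moreover have "(\<Sum>n\<in>X. C r n * v (\<kappa> s) s n) = (\<Sum>n<N. C r n * v (\<kappa> s) s n)" if "s \<in> R" for r s
    using that X by (intro sum.mono_neutral_left) (auto simp: v1)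
  ultimately have "mutually_inverse X R (\<lambda>n r. v (\<kappa> r) r n) C"
    using C R X by (auto simp: mutually_inverse_def subset_iff)
  moreover have "v (\<kappa> r) r n = of_bool (n \<in> A (\<kappa> r)) * z n ^ r" if "r \<in> R" for r n
    using that by (simp add: v_def A'_def R_def)
  ultimately have "mutually_inverse X R (\<lambda>n r. of_bool (n \<in> A (\<kappa> r)) * z n ^ r) C"
    unfolding mutually_inverse_def by (simp cong: sum.cong)
  then show ?thesis
    using that[of \<kappa> C] \<kappa> by (simp add: X_def R_def)
qed

section \<open>Trigonometric polynomials and approximation on the circle\<close>

text \<open>The inductive form makes closure under products a double induction on single harmonics;
  explicit frequencies and coefficients are recovered only in
  \<open>trig_polynomial_eq_sum\<close>.\<close>

inductive trig_polynomial :: "real \<Rightarrow> (real \<Rightarrow> complex) \<Rightarrow> bool" for a where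
  harmonic: "trig_polynomial a (\<lambda>x. c * cis (of_int j * a * x))"
| add: "trig_polynomial a f \<Longrightarrow> trig_polynomial a g \<Longrightarrow> trig_polynomial a (\<lambda>x. f x + g x)"

lemma trig_polynomial_mult:
  assumes "trig_polynomial a f" "trig_polynomial a g"
  shows "trig_polynomial a (\<lambda>x. f x * g x)"
  using assms(1)
proof induction
  case (harmonic c i)
  show ?case
    using assms(2)
  proof induction
    case (harmonic d j)
    have "(\<lambda>x. c * cis (of_int i * a * x) * (d * cis (of_int j * a * x)))
        = (\<lambda>x. (c * d) * cis (of_int (i + j) * a * x))"
      by (simp add: fun_eq_iff algebra_simps flip: cis_mult)
    then show ?case by (simp only: trig_polynomial.harmonic)
  next
    case (add f g)
    then show ?case using trig_polynomial.add by (simp add: distrib_left)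
  qed
next
  case (add f g)
  then show ?case using trig_polynomial.add by (simp add: distrib_right)
qed

lemma trig_polynomial_const: "trig_polynomial a (\<lambda>x. c)"
  using trig_polynomial.harmonic[of a c 0] by simp

lemma trig_polynomial_cis: "trig_polynomial a (\<lambda>x. cis (a * (x - b)))"
  and trig_polynomial_cis_minus: "trig_polynomial a (\<lambda>x. cis (- (a * (x - b))))"
proof -
  show "trig_polynomial a (\<lambda>x. cis (a * (x - b)))"
    using trig_polynomial.harmonic[of a "cis (- (a * b))" 1]
    by (simp add: cis_mult algebra_simps)
  show "trig_polynomial a (\<lambda>x. cis (- (a * (x - b))))"
    using trig_polynomial.harmonic[of a "cis (a * b)" "-1"]
    by (simp add: cis_mult algebra_simps)
qed

text \<open>A real-linear functional \<open>f\<close> takes the value f(1) cos t + f(\<i>) sin t on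
  the circle, which Euler's formulas turn into harmonics of frequency 1 and -1; products are covered
  by \<open>trig_polynomial_mult\<close>.\<close>

lemma trig_polynomial_real_polynomial:
  assumes "real_polynomial_function p"
  shows "trig_polynomial a (\<lambda>x. complex_of_real (p (cis (a * (x - b)))))"
  using assms
proof induction
  case (linear f)
  have eq: "complex_of_real (f (cis t))
      = of_real (f 1) / 2 * (cis t + cis (- t)) + of_real (f \<i>) / (2 * \<i>) * (cis t + (- 1) * cis (- t))" for t
  proof -
    have "cis t = cos t *\<^sub>R 1 + sin t *\<^sub>R \<i>" by (simp add: complex_eq_iff)
    then have "f (cis t) = cos t * f 1 + sin t * f \<i>"
      using linear by (simp add: bounded_linear.linear linear_add linear_cmul)
    moreover have "cis t + cis (- t) = 2 * of_real (cos t)"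
      "cis t + (- 1) * cis (- t) = 2 * \<i> * of_real (sin t)"
      by (simp_all add: complex_eq_iff)
    ultimately show ?thesis by (simp only:) (simp add: complex_eq_iff)
  qed
  show ?case
    unfolding eq by (intro trig_polynomial.add trig_polynomial_mult trig_polynomial_const
        trig_polynomial_cis trig_polynomial_cis_minus)
next
  case (const c)
  show ?case by (rule trig_polynomial_const)
next
  case (add f g)
  then show ?case using trig_polynomial.add by simp
next
  case (mult f g)
  then show ?case using trig_polynomial_mult by simp
qed

lemma trig_polynomial_polynomial:
  fixes p :: "complex \<Rightarrow> complex"
  assumes "polynomial_function p"
  shows "trig_polynomial a (\<lambda>x. p (cis (a * (x - b))))"
proof -
  have "real_polynomial_function (\<lambda>z. Re (p z))" "real_polynomial_function (\<lambda>z. Im (p z))"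
    using assms bounded_linear_Re bounded_linear_Im by (auto simp: polynomial_function_def o_def)
  then have "trig_polynomial a (\<lambda>x. of_real (Re (p (cis (a * (x - b)))))
      + \<i> * of_real (Im (p (cis (a * (x - b))))))"
    by (intro trig_polynomial.add trig_polynomial_mult trig_polynomial_const)
       (auto intro: trig_polynomial_real_polynomial)
  then show ?thesis by (simp flip: complex_eq)
qed

text \<open>Frequencies shared by two summands are merged by extending both coefficient families by
  0 to the union of the frequency sets.\<close>

lemma trig_polynomial_eq_sum:
  assumes "trig_polynomial a f"
  shows "\<exists>F c. finite F \<and> f = (\<lambda>x. \<Sum>j\<in>F. c j * cis (of_int j * a * x))"
  using assms
proof induction
  case (harmonic c j)
  show ?case by (rule exI[of _ "{j}"], rule exI[of _ "\<lambda>_. c"]) simp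
next
  case (add f g)
  then obtain F c G d where F: "finite F" "f = (\<lambda>x. \<Sum>j\<in>F. c j * cis (of_int j * a * x))"
    and G: "finite G" "g = (\<lambda>x. \<Sum>j\<in>G. d j * cis (of_int j * a * x))"
    by blast
  have "f x = (\<Sum>j\<in>F \<union> G. (if j \<in> F then c j else 0) * cis (of_int j * a * x))" for x
    unfolding F(2) using F(1) G(1) by (intro sum.mono_neutral_cong_left) auto
  moreover have "g x = (\<Sum>j\<in>F \<union> G. (if j \<in> G then d j else 0) * cis (of_int j * a * x))" for x
    unfolding G(2) using F(1) G(1) by (intro sum.mono_neutral_cong_left) auto
  ultimately have "(\<lambda>x. f x + g x) = (\<lambda>x. \<Sum>j\<in>F \<union> G.
      ((if j \<in> F then c j else 0) + (if j \<in> G then d j else 0)) * cis (of_int j * a * x))"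
    by (simp only: sum.distrib distrib_right)
  with F(1) G(1) show ?case by (intro exI[of _ "F \<union> G"] exI conjI) auto
qed

text \<open>On the circle \<open>Arg2pi\<close> jumps only at 1. The cut-off factor vanishes there,
  and since \<open>h\<close> is bounded the product tends to 0.\<close>

lemma continuous_on_sphere_cut:
  fixes h :: "real \<Rightarrow> complex"
  assumes h: "continuous_on UNIV h" and M: "\<And>x. norm (h x) \<le> M" and "0 \<le> C"
  shows "continuous_on (sphere 0 1) (\<lambda>z. of_real (min 1 (C * norm (z - 1))) * h (b + Arg2pi z / a))"
  unfolding continuous_on_eq_continuous_within
proof
  fix z :: complex assume z: "z \<in> sphere 0 1"
  let ?F = "\<lambda>z. of_real (min 1 (C * norm (z - 1))) * h (b + Arg2pi z / a)"
  have "isCont ?F z"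
  proof (cases "z = 1")
    case False
    then have "z \<notin> \<real>\<^sub>\<ge>\<^sub>0"
      using z by (auto elim!: nonneg_Reals_cases)
    then have "isCont Arg2pi z" by (rule continuous_at_Arg2pi)
    then have "isCont (\<lambda>z. b + Arg2pi z / a) z"
      by (auto simp: divide_inverse intro!: continuous_intros)
    moreover have "isCont h x" for x
      using h by (simp add: continuous_on_eq_continuous_at)
    ultimately have "isCont (\<lambda>z. h (b + Arg2pi z / a)) z"
      by (rule isCont_o2)
    then show ?thesis by (intro continuous_intros)
  next
    case True
    have "((\<lambda>w::complex. M * (C * norm (w - 1))) \<longlongrightarrow> M * (C * norm (1 - 1 :: complex))) (at 1)"
      by (intro tendsto_intros)
    then have lim: "((\<lambda>w. M * (C * norm (w - 1))) \<longlongrightarrow> 0) (at (1 :: complex))" by simp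
    have M0: "0 \<le> M" using M[of 0] norm_ge_zero[of "h 0"] by linarith
    have "norm (?F w) \<le> M * (C * norm (w - 1))" for w
    proof -
      have "norm (?F w) = min 1 (C * norm (w - 1)) * norm (h (b + Arg2pi w / a))"
        using \<open>0 \<le> C\<close> by (simp add: norm_mult del: of_real_mult)
      also have "\<dots> \<le> (C * norm (w - 1)) * M"
        using M \<open>0 \<le> C\<close> M0 by (intro mult_mono) auto
      finally show ?thesis by (simp add: mult.commute)
    qed
    then have "(?F \<longlongrightarrow> 0) (at 1)"
      by (intro Lim_null_comparison[OF _ lim] always_eventually allI)
    then show ?thesis using True by (simp add: isCont_def)
  qed
  then show "continuous (at z within sphere 0 1) ?F"
    by (rule continuous_at_imp_continuous_at_within)
qed

text \<open>A bounded measurable function is an almost everywhere limit of continuous functions; cut off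
  near the end points of a period they live on the unit circle, where the theorem of
  Stone and Weierstrass applies.\<close>

lemma bounded_measurable_trig_approx:
  fixes f :: "real \<Rightarrow> complex"
  assumes f: "f \<in> borel_measurable lebesgue" and M: "\<And>x. norm (f x) \<le> M" and a: "0 < a"
  shows "\<exists>P. (\<forall>n. trig_polynomial a (P n)) \<and> (\<forall>n x. norm (P n x) \<le> M + 1) \<and>
    (\<exists>Z. negligible Z \<and> (\<forall>x\<in>{b<..<b + 2 * pi / a} - Z. (\<lambda>n. P n x) \<longlonglongrightarrow> f x))"
proof -
  have M0: "0 \<le> M" using M[of 0] norm_ge_zero[of "f 0"] by linarith
  have "f measurable_on UNIV"
    using f by (simp add: measurable_on_iff_borel_measurable lebesgue_on_UNIV_eq)
  then obtain Z g where Z: "negligible Z" and g: "\<And>n. continuous_on UNIV (g n)"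
    and lim: "\<And>x. x \<notin> Z \<Longrightarrow> (\<lambda>n. g n x) \<longlonglongrightarrow> f x"
    by (auto simp: measurable_on_def)
  \<comment> \<open>Projecting to the ball of radius \<open>M\<close> gives the continuous
    approximants \<open>g n\<close> a uniform bound; the limit is unaffected because
    \<open>f\<close> takes its values in that ball.\<close>
  define clip where "clip = closest_point (cball (0::complex) M)"
  have clip: "continuous_on UNIV clip" "\<And>z. norm (clip z) \<le> M" "\<And>z. norm z \<le> M \<Longrightarrow> clip z = z"
    unfolding clip_def
    using continuous_on_closest_point[of "cball (0::complex) M" UNIV]
      closest_point_in_set[of "cball (0::complex) M"] M0
    by (auto simp: closest_point_self)
  \<comment> \<open>The slope \<open>n\<close> of the cut-off grows, so at each point other than 1
    the factor is eventually equal to 1.\<close>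
  define F where "F n z = of_real (min 1 (real n * norm (z - 1))) * clip (g n (b + Arg2pi z / a))"
    for n and z :: complex
  have normF: "norm (F n z) \<le> M" for n z
  proof -
    have "norm (F n z) = min 1 (real n * norm (z - 1)) * norm (clip (g n (b + Arg2pi z / a)))"
      by (simp add: F_def norm_mult del: of_real_mult)
    also have "\<dots> \<le> 1 * M" using clip M0 by (intro mult_mono) auto
    finally show ?thesis by simp
  qed
  have "continuous_on (sphere 0 1) (F n)" for n
    unfolding F_def
    by (rule continuous_on_sphere_cut[where h = "\<lambda>x. clip (g n x)" and M = M])
       (use clip in \<open>auto intro!: continuous_on_compose2[OF clip(1) g]\<close>)
  then have "\<exists>p. polynomial_function p \<and> (\<forall>z\<in>sphere 0 1. norm (F n z - p z) < inverse (Suc n))" for n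
    by (intro Stone_Weierstrass_polynomial_function) auto
  then obtain p where p: "\<And>n. polynomial_function (p n)"
    and Fp: "\<And>n z. z \<in> sphere 0 1 \<Longrightarrow> norm (F n z - p n z) < inverse (Suc n)"
    by metis
  define P where "P n x = p n (cis (a * (x - b)))" for n x
  have FP: "norm (F n (cis (a * (x - b))) - P n x) < inverse (Suc n)" for n x
    unfolding P_def by (rule Fp) simp
  have "trig_polynomial a (P n)" for n
    unfolding P_def using p by (rule trig_polynomial_polynomial)
  moreover have "norm (P n x) \<le> M + 1" for n x
  proof -
    have "norm (P n x) \<le> norm (F n (cis (a * (x - b)))) + norm (F n (cis (a * (x - b))) - P n x)"
      using norm_triangle_sub[of "P n x" "F n (cis (a * (x - b)))"] by (simp add: norm_minus_commute)
    moreover have "inverse (real (Suc n)) \<le> 1" by (simp add: field_simps)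
    ultimately show ?thesis using normF[of n "cis (a * (x - b))"] FP[of n x] by linarith
  qed
  moreover have "(\<lambda>n. P n x) \<longlonglongrightarrow> f x" if x: "x \<in> {b<..<b + 2 * pi / a} - Z" for x
  proof -
    define t where "t = a * (x - b)"
    have t: "0 < t" "t < 2 * pi" using x a by (auto simp: t_def field_simps)
    have Arg: "Arg2pi (cis t) = t"
      using Arg2pi_unique[of 1 t "cis t"] t by (simp add: cis_conv_exp)
    have "cis t \<noteq> 1"
      using Arg t Arg2pi_unique[of 1 0 1] by auto
    then have nz: "0 < norm (cis t - 1)" by simp
    have "eventually (\<lambda>n. real n * norm (cis t - 1) \<ge> 1) sequentially"
      using eventually_ge_at_top[of "nat \<lceil>1 / norm (cis t - 1)\<rceil>"]
    proof eventually_elim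
      case (elim n)
      then have "1 / norm (cis t - 1) \<le> real n" by linarith
      then show ?case using nz by (simp add: field_simps)
    qed
    then have ev: "eventually (\<lambda>n. clip (g n x) = F n (cis t)) sequentially"
    proof eventually_elim
      case (elim n)
      have "b + t / a = x" using a by (simp add: t_def)
      with elim show ?case by (simp add: F_def Arg min_absorb1)
    qed
    have "isCont clip (f x)" using clip(1) by (simp add: continuous_on_eq_continuous_at)
    then have "(\<lambda>n. clip (g n x)) \<longlonglongrightarrow> clip (f x)"
      by (rule isCont_tendsto_compose) (use x in \<open>simp add: lim\<close>)
    then have "(\<lambda>n. clip (g n x)) \<longlonglongrightarrow> f x" by (simp add: clip(3) M)
    then have FL: "(\<lambda>n. F n (cis t)) \<longlonglongrightarrow> f x"
      using ev by (rule Lim_transform_eventually)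
    have "(\<lambda>n. F n (cis t) - P n x) \<longlonglongrightarrow> 0"
      by (rule Lim_null_comparison[OF _ LIMSEQ_inverse_real_of_nat])
         (use FP[of _ x] in \<open>auto simp: t_def less_imp_le intro!: always_eventually\<close>)
    from tendsto_diff[OF FL this] show ?thesis by simp
  qed
  ultimately show ?thesis using Z by blast
qed

section \<open>Elementary estimates for square-integrable functions\<close>

lemma L2_iff:
  "f \<in> L2 S \<longleftrightarrow> f \<in> borel_measurable (lebesgue_on S) \<and>
     integrable (lebesgue_on S) (\<lambda>x. (norm (f x))\<^sup>2)"
  by (simp add: L2_def)

lemma L2_norm_nonneg: "0 \<le> L2_norm S f"
  by (simp add: L2_norm_def)

lemma L2_norm_power2: "(L2_norm S f)\<^sup>2 = (\<integral>x. (norm (f x))\<^sup>2 \<partial>(lebesgue_on S))"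
  by (simp add: L2_norm_def)

lemma L2_bound:
  assumes "f \<in> borel_measurable (lebesgue_on S)" "integrable (lebesgue_on S) h"
    and "\<And>x. x \<in> S \<Longrightarrow> (norm (f x))\<^sup>2 \<le> h x"
  shows "f \<in> L2 S" "(L2_norm S f)\<^sup>2 \<le> (\<integral>x. h x \<partial>(lebesgue_on S))"
proof -
  have i: "integrable (lebesgue_on S) (\<lambda>x. (norm (f x))\<^sup>2)"
    using assms by (intro Bochner_Integration.integrable_bound[OF assms(2)])
      (auto intro!: AE_I2 order_trans[OF assms(3)])
  then show "f \<in> L2 S" using assms by (simp add: L2_iff)
  show "(L2_norm S f)\<^sup>2 \<le> (\<integral>x. h x \<partial>(lebesgue_on S))"
    unfolding L2_norm_power2 using i assms by (intro integral_mono) auto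
qed

text \<open>The Cauchy-Schwarz inequality for the finite sum, applied pointwise. The factor
  \<open>card I\<close> is harmless, and the estimate takes the place of the triangle inequality for
  the norm.\<close>

lemma L2_sum:
  assumes "finite I" "\<And>i. i \<in> I \<Longrightarrow> f i \<in> L2 S"
  shows "(\<lambda>x. \<Sum>i\<in>I. f i x) \<in> L2 S"
    and "(L2_norm S (\<lambda>x. \<Sum>i\<in>I. f i x))\<^sup>2 \<le> card I * (\<Sum>i\<in>I. (L2_norm S (f i))\<^sup>2)"
proof -
  have meas: "(\<lambda>x. \<Sum>i\<in>I. f i x) \<in> borel_measurable (lebesgue_on S)"
    using assms by (intro borel_measurable_sum) (auto simp: L2_iff)
  have int: "integrable (lebesgue_on S) (\<lambda>x. card I * (\<Sum>i\<in>I. (norm (f i x))\<^sup>2))"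
    using assms by (intro integrable_mult_right integrable_sum) (auto simp: L2_iff)
  have le: "(norm (\<Sum>i\<in>I. f i x))\<^sup>2 \<le> card I * (\<Sum>i\<in>I. (norm (f i x))\<^sup>2)" for x
  proof -
    have "(norm (\<Sum>i\<in>I. f i x))\<^sup>2 \<le> (\<Sum>i\<in>I. norm (f i x))\<^sup>2"
      by (intro power_mono norm_sum) auto
    also have "\<dots> \<le> (\<Sum>i\<in>I. (norm (f i x))\<^sup>2) * card I"
      by (rule sum_squared_le_sum_of_squares)
    finally show ?thesis by (simp add: mult.commute)
  qed
  show "(\<lambda>x. \<Sum>i\<in>I. f i x) \<in> L2 S"
    using meas int le by (rule L2_bound)
  have "(L2_norm S (\<lambda>x. \<Sum>i\<in>I. f i x))\<^sup>2
      \<le> (\<integral>x. card I * (\<Sum>i\<in>I. (norm (f i x))\<^sup>2) \<partial>(lebesgue_on S))"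
    using meas int le by (rule L2_bound)
  also have "\<dots> = card I * (\<Sum>i\<in>I. (L2_norm S (f i))\<^sup>2)"
    using assms by (subst integral_mult_right_zero) (simp add: L2_norm_power2 L2_iff)
  finally show "(L2_norm S (\<lambda>x. \<Sum>i\<in>I. f i x))\<^sup>2 \<le> card I * (\<Sum>i\<in>I. (L2_norm S (f i))\<^sup>2)" .
qed

lemma L2_scale: "f \<in> L2 S \<Longrightarrow> (\<lambda>x. a * f x) \<in> L2 S"
  by (auto simp: L2_iff norm_mult power_mult_distrib)

lemma L2_add:
  assumes "f \<in> L2 S" "g \<in> L2 S"
  shows "(\<lambda>x. f x + g x) \<in> L2 S"
    and "(L2_norm S (\<lambda>x. f x + g x))\<^sup>2 \<le> 2 * ((L2_norm S f)\<^sup>2 + (L2_norm S g)\<^sup>2)"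
  using L2_sum[of UNIV "\<lambda>b. if b then f else g" S] assms by (simp_all add: UNIV_bool add.commute)

lemma L2_diff:
  assumes "f \<in> L2 S" "g \<in> L2 S"
  shows "(\<lambda>x. f x - g x) \<in> L2 S"
  using L2_add(1)[OF assms(1) L2_scale[OF assms(2), of "-1"]] by simp

lemma L2_norm_eq_0_imp_AE:
  assumes "f \<in> L2 S" "L2_norm S f = 0"
  shows "AE x in lebesgue_on S. f x = 0"
proof -
  have "(\<integral>x. (norm (f x))\<^sup>2 \<partial>(lebesgue_on S)) = 0"
    using assms(2) L2_norm_power2[of S f] by simp
  then have "AE x in lebesgue_on S. (norm (f x))\<^sup>2 = 0"
    using assms(1) by (subst (asm) integral_nonneg_eq_0_iff_AE) (auto simp: L2_iff)
  then show ?thesis by eventually_elim simp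
qed

section \<open>Unions of cells and approximation in L2\<close>

text \<open>\<open>cell N n\<close> leaves out the end points, so the translations between cells are exact and
  statements about a union of cells hold only up to a null set.\<close>

definition cell :: "nat \<Rightarrow> nat \<Rightarrow> real set" where
  "cell N n = {real n / real N <..< (real n + 1) / real N}"

lemma cell_measurable [measurable, simp]: "cell N n \<in> sets borel" "cell N n \<in> sets lebesgue"
  by (simp_all add: cell_def)

lemma cell_shift_iff:
  "x + (real q - real p) / real N \<in> cell N q \<longleftrightarrow> x \<in> cell N p"
  by (auto simp: cell_def diff_divide_distrib add_divide_distrib)

lemma cell_unique:
  assumes "x \<in> cell N p" "x \<in> cell N q"
  shows "p = q"
proof -
  have "N \<noteq> 0" using assms(1) by (intro notI) (simp add: cell_def)
  then have "real p < N * x" "N * x < real p + 1" "real q < N * x" "N * x < real q + 1"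
    using assms by (auto simp: cell_def field_simps)
  then show ?thesis by linarith
qed

locale cell_union =
  fixes S :: "real set" and N :: nat and A :: "nat set"
  assumes N_pos: "0 < N" and finite_A: "finite A"
    and lmeasurable_S: "S \<in> lmeasurable"
    and cell_subset: "p \<in> A \<Longrightarrow> cell N p \<subseteq> S"
    and negligible_rest: "negligible (S - (\<Union>p\<in>A. cell N p))"
begin

lemma sets_S [simp]: "S \<in> sets lebesgue"
  using lmeasurable_S by (rule fmeasurableD)

lemma AE_cell: "AE x in lebesgue_on S. \<exists>p\<in>A. x \<in> cell N p"
proof -
  have "S - (\<Union>p\<in>A. cell N p) \<in> null_sets lebesgue"
    using negligible_rest by (simp add: negligible_iff_null_sets)
  from AE_not_in[OF this] show ?thesis
    by (auto simp: AE_restrict_space_iff)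
qed

lemma sum_indicator_cell:
  fixes f :: "nat \<Rightarrow> complex"
  assumes "p \<in> A" "x \<in> cell N p"
  shows "(\<Sum>q\<in>A. indicator (cell N q) x * f q) = f p"
proof -
  have "(\<Sum>q\<in>A. indicator (cell N q) x * f q) = (\<Sum>q\<in>A. if p = q then f q else 0)"
    using assms by (intro sum.cong) (auto simp: indicator_def dest: cell_unique)
  then show ?thesis using assms finite_A by simp
qed

lemma finite_measure_S: "finite_measure (lebesgue_on S)"
  using lmeasurable_S by (rule finite_measure_lebesgue_on)

lemma L2_norm_tendsto_0:
  assumes "\<And>n. f n \<in> borel_measurable (lebesgue_on S)" "integrable (lebesgue_on S) h"
    and "\<And>n x. x \<in> S \<Longrightarrow> (norm (f n x))\<^sup>2 \<le> h x"
    and "AE x in lebesgue_on S. (\<lambda>n. f n x) \<longlonglongrightarrow> 0"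
  shows "(\<lambda>n. L2_norm S (f n)) \<longlonglongrightarrow> 0"
proof -
  have "(\<lambda>n. \<integral>x. (norm (f n x))\<^sup>2 \<partial>(lebesgue_on S)) \<longlonglongrightarrow> (\<integral>x. 0 \<partial>(lebesgue_on S))"
  proof (rule integral_dominated_convergence[OF _ _ assms(2)])
    show "AE x in lebesgue_on S. (\<lambda>n. (norm (f n x))\<^sup>2) \<longlonglongrightarrow> 0"
      using assms(4)
    proof eventually_elim
      case (elim x)
      from tendsto_power[OF tendsto_norm[OF this], of 2] show ?case by simp
    qed
    show "AE x in lebesgue_on S. norm ((norm (f n x))\<^sup>2) \<le> h x" for n
      using assms(3) by (intro AE_I2) simp
  qed (use assms(1) in auto)
  from tendsto_real_sqrt[OF this] show ?thesis
    by (simp add: L2_norm_def)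
qed

text \<open>Truncation at height \<open>m\<close>: at each point the error is eventually 0, and its
  square is dominated by that of \<open>g\<close>.\<close>

lemma L2_bounded_approx:
  assumes g: "g \<in> L2 S" and "0 < \<epsilon>"
  obtains f M where "f \<in> borel_measurable lebesgue" "\<And>x. norm (f x) \<le> M"
    "(\<lambda>x. g x - f x) \<in> L2 S" "L2_norm S (\<lambda>x. g x - f x) < \<epsilon>"
proof -
  \<comment> \<open>Extension by 0 makes the truncations measurable on the whole line, as the
    approximation by trigonometric polynomials requires.\<close>
  define g0 where "g0 x = (if x \<in> S then g x else 0)" for x
  have g0[measurable]: "g0 \<in> borel_measurable lebesgue"
    unfolding g0_def using g sets_S by (simp only: borel_measurable_if L2_iff)
  define f where "f m x = (if norm (g0 x) \<le> real m then g0 x else 0)" for m x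
  have f[measurable]: "f m \<in> borel_measurable lebesgue" for m
    unfolding f_def by measurable
  have gm: "g \<in> borel_measurable (lebesgue_on S)" using g by (simp add: L2_iff)
  have m: "(\<lambda>x. g x - f m x) \<in> borel_measurable (lebesgue_on S)" for m
    using gm measurable_restrict_space1[OF f] by (rule borel_measurable_diff)
  have h: "integrable (lebesgue_on S) (\<lambda>x. (norm (g x))\<^sup>2)" using g by (simp add: L2_iff)
  have le: "(norm (g x - f m x))\<^sup>2 \<le> (norm (g x))\<^sup>2" if "x \<in> S" for m x
    using that by (simp add: f_def g0_def)
  have "(\<lambda>m. g x - f m x) \<longlonglongrightarrow> 0" if "x \<in> S" for x
  proof (rule tendsto_eventually)
    show "eventually (\<lambda>m. g x - f m x = 0) sequentially"
      using eventually_ge_at_top[of "nat \<lceil>norm (g x)\<rceil>"]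
    proof eventually_elim
      case (elim m)
      then have "norm (g x) \<le> real m" by linarith
      then show ?case using that by (simp add: f_def g0_def)
    qed
  qed
  then have "AE x in lebesgue_on S. (\<lambda>m. g x - f m x) \<longlonglongrightarrow> 0"
    by (intro AE_I2) simp
  from L2_norm_tendsto_0[OF m h le this] \<open>0 < \<epsilon>\<close>
  have "eventually (\<lambda>m. L2_norm S (\<lambda>x. g x - f m x) < \<epsilon>) sequentially"
    by (auto dest: order_tendstoD)
  then obtain m where "L2_norm S (\<lambda>x. g x - f m x) < \<epsilon>"
    by (auto simp: eventually_sequentially)
  moreover have "norm (f m x) \<le> real m" for x by (simp add: f_def)
  moreover have "(\<lambda>x. g x - f m x) \<in> L2 S"
    using m h le by (rule L2_bound)
  ultimately show ?thesis using that f by blast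
qed

lemma borel_measurable_trig_polynomial:
  "trig_polynomial a P \<Longrightarrow> P \<in> borel_measurable borel"
proof (induction rule: trig_polynomial.induct)
  case (harmonic c j)
  show ?case
    by (intro borel_measurable_continuous_onI continuous_intros)
next
  case (add f g)
  from add.IH show ?case by (rule borel_measurable_add)
qed

text \<open>The frequency 2 pi N makes one period as long as one cell, so each cell can be given its
  own sequence of polynomials. Their uniform bound permits dominated convergence on the set
  \<open>S\<close> of finite measure.\<close>

lemma L2_trig_approx:
  assumes f: "f \<in> borel_measurable lebesgue" "\<And>x. norm (f x) \<le> M" and "0 < \<epsilon>"
  obtains P where "\<And>p. trig_polynomial (2 * pi * real N) (P p)"
    "(\<lambda>x. f x - (\<Sum>p\<in>A. indicator (cell N p) x * P p x)) \<in> L2 S"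
    "L2_norm S (\<lambda>x. f x - (\<Sum>p\<in>A. indicator (cell N p) x * P p x)) < \<epsilon>"
proof -
  have a: "0 < 2 * pi * real N" using N_pos by simp
  have cell_eq: "{real p / N <..< real p / N + 2 * pi / (2 * pi * real N)} = cell N p" for p
    by (simp add: cell_def add_divide_distrib)
  have "\<exists>P. (\<forall>n. trig_polynomial (2 * pi * real N) (P n)) \<and> (\<forall>n x. norm (P n x) \<le> M + 1) \<and>
    (\<exists>Z. negligible Z \<and> (\<forall>x\<in>cell N p - Z. (\<lambda>n. P n x) \<longlonglongrightarrow> f x))" for p
    using bounded_measurable_trig_approx[OF f a, of "real p / N"] unfolding cell_eq .
  then obtain P Z where P: "\<And>p n. trig_polynomial (2 * pi * real N) (P p n)"
    and norm_P: "\<And>p n x. norm (P p n x) \<le> M + 1"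
    and Z: "\<And>p. negligible (Z p)"
    and lim: "\<And>p x. x \<in> cell N p - Z p \<Longrightarrow> (\<lambda>n. P p n x) \<longlonglongrightarrow> f x"
    by metis
  define D where "D n x = f x - (\<Sum>p\<in>A. indicator (cell N p) x * P p n x)" for n x
  have P_meas: "P p n \<in> borel_measurable lebesgue" for p n
    using borel_measurable_trig_polynomial[OF P] by (intro measurable_completion) simp
  have "D n \<in> borel_measurable lebesgue" for n
    unfolding D_def using P_meas f(1)
    by (intro borel_measurable_diff borel_measurable_sum borel_measurable_times) auto
  then have D_meas: "D n \<in> borel_measurable (lebesgue_on S)" for n
    by (rule measurable_restrict_space1)
  \<comment> \<open>A crude bound: \<open>M\<close> for \<open>f\<close>, and \<open>M + 1\<close>
    for the polynomial of every cell.\<close>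
  define C where "C = M + (\<Sum>p\<in>A. M + 1)"
  have D_bound: "(norm (D n x))\<^sup>2 \<le> C\<^sup>2" for n x
  proof (rule power_mono)
    have "norm (D n x) \<le> norm (f x) + norm (\<Sum>p\<in>A. indicator (cell N p) x * P p n x)"
      unfolding D_def by (rule norm_triangle_ineq4)
    also have "norm (\<Sum>p\<in>A. indicator (cell N p) x * P p n x) \<le> (\<Sum>p\<in>A. M + 1)"
    proof (rule sum_norm_le)
      fix p
      have "norm (indicator (cell N p) x * P p n x) \<le> 1 * norm (P p n x)"
        unfolding norm_mult by (intro mult_right_mono) (auto simp: indicator_def)
      then show "norm (indicator (cell N p) x * P p n x) \<le> M + 1"
        using norm_P[of p n x] by linarith
    qed
    finally show "norm (D n x) \<le> C" using f(2)[of x] by (simp add: C_def)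
  qed simp
  have C_int: "integrable (lebesgue_on S) (\<lambda>x. C\<^sup>2)"
    using finite_measure_S by (simp add: finite_measure.integrable_const)
  have "(\<Union>p\<in>A. Z p) \<in> null_sets lebesgue"
    using Z finite_A by (auto simp: negligible_iff_null_sets)
  from AE_not_in[OF this] have "AE x in lebesgue_on S. x \<notin> (\<Union>p\<in>A. Z p)"
    by (auto simp: AE_restrict_space_iff elim: eventually_mono)
  with AE_cell have "AE x in lebesgue_on S. (\<lambda>n. D n x) \<longlonglongrightarrow> 0"
  proof eventually_elim
    case (elim x)
    then obtain p where p: "p \<in> A" "x \<in> cell N p" "x \<notin> Z p" by auto
    have "D n x = f x - P p n x" for n
      unfolding D_def using p by (subst sum_indicator_cell[of p]) auto
    moreover have "(\<lambda>n. f x - P p n x) \<longlonglongrightarrow> f x - f x"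
      using p by (intro tendsto_diff tendsto_const lim) auto
    ultimately show ?case by simp
  qed
  from L2_norm_tendsto_0[OF D_meas C_int D_bound this] \<open>0 < \<epsilon>\<close>
  have "eventually (\<lambda>n. L2_norm S (D n) < \<epsilon>) sequentially"
    by (auto dest: order_tendstoD)
  then obtain n where "L2_norm S (D n) < \<epsilon>" by (auto simp: eventually_sequentially)
  moreover have "D n \<in> L2 S" using D_meas C_int D_bound by (rule L2_bound)
  ultimately show ?thesis
    using that[of "\<lambda>p. P p n"] P by (simp add: D_def[abs_def])
qed

end

section \<open>Operators that multiply by a matrix across cells\<close>

text \<open>In the coordinate \<open>y = x - p / N\<close> of the cells, an element of \<open>L\<^sup>2\<close> is a vector of functions
  of \<open>y\<close> indexed by \<open>A\<close>, and \<open>cell_op N A c\<close> is multiplication by the matrix \<open>c p q y\<close>.\<close>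

definition cell_op ::
    "nat \<Rightarrow> nat set \<Rightarrow> (nat \<Rightarrow> nat \<Rightarrow> real \<Rightarrow> complex) \<Rightarrow> (real \<Rightarrow> complex) \<Rightarrow> real \<Rightarrow> complex" where
  "cell_op N A c f x = (\<Sum>p\<in>A. \<Sum>q\<in>A. indicator (cell N p) x *
     (c p q (x - real p / N) * f (x + (real q - real p) / N)))"

lemma cell_op_add: "cell_op N A c (\<lambda>x. f x + g x) x = cell_op N A c f x + cell_op N A c g x"
  by (simp add: cell_op_def distrib_left sum.distrib)

lemma cell_op_scale: "cell_op N A c (\<lambda>x. a * f x) x = a * cell_op N A c f x"
  by (simp add: cell_op_def sum_distrib_left mult.left_commute)

context cell_union
begin

lemma cell_op_at:
  assumes "p \<in> A" "x \<in> cell N p"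
  shows "cell_op N A c f x = (\<Sum>q\<in>A. c p q (x - real p / N) * f (x + (real q - real p) / N))"
  unfolding cell_op_def sum_distrib_left[symmetric] by (rule sum_indicator_cell[OF assms])

text \<open>Translation invariance of Lebesgue measure: \<open>h\<close> is the part of
  \<open>f\<close> on the cell \<open>q\<close>, moved to the cell \<open>p\<close> and multiplied
  by a factor of norm at most \<open>C\<close>.\<close>

lemma L2_cell_shift:
  assumes f: "f \<in> L2 S" and c: "continuous_on UNIV c" "\<And>y. norm (c y) \<le> C"
    and pq: "p \<in> A" "q \<in> A"
  defines "h \<equiv> \<lambda>x. indicator (cell N p) x * (c (x - real p / N) * f (x + (real q - real p) / N))"
  shows "h \<in> L2 S" and "(L2_norm S h)\<^sup>2 \<le> C\<^sup>2 * (L2_norm S f)\<^sup>2"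
proof -
  define t where "t = (real q - real p) / N"
  define f0 where "f0 x = (if x \<in> S then f x else 0)" for x
  \<comment> \<open>Cutting to the cell \<open>q\<close> before translating lets the translation act
    on a function defined on the whole line, whatever the values of \<open>f\<close> outside
    \<open>S\<close>.\<close>
  define fq where "fq x = indicator (cell N q) x * f0 x" for x
  have f0_meas: "f0 \<in> borel_measurable lebesgue"
    unfolding f0_def using f sets_S by (simp only: borel_measurable_if L2_iff)
  have f0_int: "integrable lebesgue (\<lambda>x. (norm (f0 x))\<^sup>2)"
  proof -
    have "integrable lebesgue (\<lambda>x. if x \<in> S then (norm (f x))\<^sup>2 else 0)"
      using f sets_S by (subst Lebesgue_Measure.integrable_restrict_UNIV) (auto simp: L2_iff)
    also have "(\<lambda>x. if x \<in> S then (norm (f x))\<^sup>2 else 0) = (\<lambda>x. (norm (f0 x))\<^sup>2)"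
      by (auto simp: f0_def)
    finally show ?thesis .
  qed
  have f0_integral: "(\<integral>x. (norm (f0 x))\<^sup>2 \<partial>lebesgue) = (L2_norm S f)\<^sup>2"
  proof -
    have "(\<integral>x. (norm (f0 x))\<^sup>2 \<partial>lebesgue) = (\<integral>x. (if x \<in> S then (norm (f x))\<^sup>2 else 0) \<partial>lebesgue)"
      by (intro Bochner_Integration.integral_cong) (auto simp: f0_def)
    also have "\<dots> = (L2_norm S f)\<^sup>2"
      unfolding L2_norm_power2 by (rule Lebesgue_Measure.integral_restrict_UNIV) (rule sets_S)
    finally show ?thesis .
  qed
  have fq_meas: "fq \<in> borel_measurable lebesgue"
    unfolding fq_def using f0_meas by (intro borel_measurable_times) auto
  have fq_le: "(norm (fq x))\<^sup>2 \<le> (norm (f0 x))\<^sup>2" for x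
    by (auto simp: fq_def indicator_def)
  have fq_int: "integrable lebesgue (\<lambda>x. (norm (fq x))\<^sup>2)"
    by (rule Bochner_Integration.integrable_bound[OF f0_int]) (use fq_meas fq_le in auto)
  have shift_meas: "(\<lambda>x. fq (t + 1 * x)) \<in> borel_measurable lebesgue"
    using borel_measurable_affine[OF fq_meas, of 1 t] by simp
  have shift_int: "integrable lebesgue (\<lambda>x. (norm (fq (t + 1 * x)))\<^sup>2)"
    by (rule lebesgue_integrable_real_affine[OF fq_int]) simp
  have shift_integral: "(\<integral>x. (norm (fq (t + 1 * x)))\<^sup>2 \<partial>lebesgue) = (\<integral>x. (norm (fq x))\<^sup>2 \<partial>lebesgue)"
    using lebesgue_integral_real_affine[of 1 "\<lambda>x. (norm (fq x))\<^sup>2" t] by simp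
  have h_eq: "h = (\<lambda>x. c (x - real p / N) * fq (t + 1 * x))"
  proof
    fix x
    have "t + x \<in> cell N q \<longleftrightarrow> x \<in> cell N p"
      using cell_shift_iff[of x q p N] by (simp add: t_def add.commute)
    moreover have "t + x \<in> S" if "t + x \<in> cell N q"
      using cell_subset[OF pq(2)] that by blast
    ultimately show "h x = c (x - real p / N) * fq (t + 1 * x)"
      by (auto simp: h_def fq_def f0_def indicator_def t_def add.commute)
  qed
  have "(\<lambda>x. c (x - real p / N)) \<in> borel_measurable borel"
    by (intro borel_measurable_continuous_onI continuous_on_compose2[OF c(1)] continuous_intros) auto
  then have "(\<lambda>x. c (x - real p / N)) \<in> borel_measurable lebesgue"
    by (intro measurable_completion) simp
  then have "h \<in> borel_measurable lebesgue"
    unfolding h_eq using shift_meas by (rule borel_measurable_times)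
  then have h_meas: "h \<in> borel_measurable (lebesgue_on S)"
    by (rule measurable_restrict_space1)
  have shift_int_S: "integrable lebesgue (\<lambda>x. if x \<in> S then (norm (fq (t + 1 * x)))\<^sup>2 else 0)"
  proof -
    have "(\<lambda>x. if x \<in> S then (norm (fq (t + 1 * x)))\<^sup>2 else 0)
        = (\<lambda>x. indicator S x *\<^sub>R (norm (fq (t + 1 * x)))\<^sup>2)"
      by (auto simp: fun_eq_iff)
    then show ?thesis using integrable_mult_indicator[OF sets_S shift_int] by (simp only:)
  qed
  then have int: "integrable (lebesgue_on S) (\<lambda>x. C\<^sup>2 * (norm (fq (t + 1 * x)))\<^sup>2)"
    unfolding Lebesgue_Measure.integrable_restrict_UNIV[OF sets_S] by (rule integrable_mult_right)
  have le: "(norm (h x))\<^sup>2 \<le> C\<^sup>2 * (norm (fq (t + 1 * x)))\<^sup>2" for x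
    unfolding h_eq norm_mult power_mult_distrib using c(2)
    by (intro mult_right_mono power_mono) auto
  show "h \<in> L2 S" using h_meas int le by (rule L2_bound)
  have "(L2_norm S h)\<^sup>2 \<le> (\<integral>x. C\<^sup>2 * (norm (fq (t + 1 * x)))\<^sup>2 \<partial>(lebesgue_on S))"
    using h_meas int le by (rule L2_bound)
  also have "\<dots> = C\<^sup>2 * (\<integral>x. (norm (fq (t + 1 * x)))\<^sup>2 \<partial>(lebesgue_on S))"
    by simp
  also have "(\<integral>x. (norm (fq (t + 1 * x)))\<^sup>2 \<partial>(lebesgue_on S))
      \<le> (\<integral>x. (norm (fq (t + 1 * x)))\<^sup>2 \<partial>lebesgue)"
    unfolding Lebesgue_Measure.integral_restrict_UNIV[OF sets_S, symmetric]
    using shift_int_S shift_int by (rule integral_mono) simp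
  also have "\<dots> \<le> (\<integral>x. (norm (f0 x))\<^sup>2 \<partial>lebesgue)"
    unfolding shift_integral using fq_int f0_int fq_le by (rule integral_mono)
  also have "\<dots> = (L2_norm S f)\<^sup>2" by (rule f0_integral)
  finally show "(L2_norm S h)\<^sup>2 \<le> C\<^sup>2 * (L2_norm S f)\<^sup>2"
    by (simp add: mult_left_mono)
qed

lemma cell_op_bounded:
  assumes c: "\<And>p q. continuous_on UNIV (c p q)" "\<And>p q y. norm (c p q y) \<le> C"
  shows "f \<in> L2 S \<Longrightarrow> cell_op N A c f \<in> L2 S"
    and "\<exists>D. \<forall>f\<in>L2 S. L2_norm S (cell_op N A c f) \<le> D * L2_norm S f"
proof -
  define h where "h f = (\<lambda>(p, q) x. indicator (cell N p) x *
     (c p q (x - real p / N) * f (x + (real q - real p) / N)))" for f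
  have eq: "cell_op N A c f = (\<lambda>x. \<Sum>i\<in>A \<times> A. h f i x)" for f
    by (simp add: cell_op_def[abs_def] h_def sum.cartesian_product case_prod_beta)
  have fin: "finite (A \<times> A)" using finite_A by simp
  have L2_h: "h f i \<in> L2 S" and norm_h: "(L2_norm S (h f i))\<^sup>2 \<le> C\<^sup>2 * (L2_norm S f)\<^sup>2"
    if "f \<in> L2 S" "i \<in> A \<times> A" for f i
    using L2_cell_shift[OF that(1) c, of "fst i" "snd i"] that(2)
    by (auto simp: h_def case_prod_beta)
  show "f \<in> L2 S \<Longrightarrow> cell_op N A c f \<in> L2 S"
    unfolding eq using fin L2_h by (intro L2_sum) auto
  define n where "n = real (card (A \<times> A))"
  have C0: "0 \<le> C" using c(2)[of 0 0 0] norm_ge_zero[of "c 0 0 0"] by linarith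
  \<comment> \<open>One factor \<open>n\<close> comes from \<open>L2_sum\<close>, the other from the
    \<open>n\<close> summands; together they give the square of \<open>n * C\<close>.\<close>
  have "L2_norm S (cell_op N A c f) \<le> (n * C) * L2_norm S f" if "f \<in> L2 S" for f
  proof (rule power2_le_imp_le)
    have "(L2_norm S (cell_op N A c f))\<^sup>2 \<le> n * (\<Sum>i\<in>A \<times> A. (L2_norm S (h f i))\<^sup>2)"
      unfolding eq n_def using fin L2_h[OF that] by (rule L2_sum)
    also have "\<dots> \<le> n * (\<Sum>i\<in>A \<times> A. C\<^sup>2 * (L2_norm S f)\<^sup>2)"
      unfolding n_def using norm_h[OF that] by (intro mult_left_mono sum_mono) auto
    also have "\<dots> = ((n * C) * L2_norm S f)\<^sup>2"
      by (simp add: n_def power2_eq_square)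
    finally show "(L2_norm S (cell_op N A c f))\<^sup>2 \<le> ((n * C) * L2_norm S f)\<^sup>2" .
  qed (use C0 L2_norm_nonneg in \<open>auto simp: n_def\<close>)
  then show "\<exists>D. \<forall>f\<in>L2 S. L2_norm S (cell_op N A c f) \<le> D * L2_norm S f" by blast
qed

text \<open>Moving from one cell to another keeps the coordinate \<open>y\<close>, so composing two
  such operators multiplies their matrices at the same \<open>y\<close>.\<close>

lemma cell_op_inverse:
  assumes cd: "\<And>p s y. p \<in> A \<Longrightarrow> s \<in> A \<Longrightarrow> (\<Sum>q\<in>A. c p q y * d q s y) = of_bool (p = s)"
  shows "ae_eq S (cell_op N A c (cell_op N A d f)) f"
  unfolding ae_eq_def using AE_cell
proof eventually_elim
  case (elim x)
  then obtain p where p: "p \<in> A" "x \<in> cell N p" by blast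
  define y where "y = x - real p / N"
  have "cell_op N A c (cell_op N A d f) x
      = (\<Sum>q\<in>A. c p q y * cell_op N A d f (x + (real q - real p) / N))"
    using p by (simp add: cell_op_at y_def)
  also have "\<dots> = (\<Sum>q\<in>A. c p q y * (\<Sum>s\<in>A. d q s y * f (x + (real s - real p) / N)))"
  proof (intro sum.cong refl arg_cong2[where f = "(*)"])
    fix q assume q: "q \<in> A"
    have "x + (real q - real p) / N \<in> cell N q" using p by (simp add: cell_shift_iff)
    note at = cell_op_at[OF q this, of d f]
    have 1: "x + (real q - real p) / N - real q / N = y"
      by (simp add: y_def diff_divide_distrib)
    have 2: "x + (real q - real p) / N + (real s - real q) / N = x + (real s - real p) / N" for s
      by (simp add: diff_divide_distrib)
    show "cell_op N A d f (x + (real q - real p) / N)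
        = (\<Sum>s\<in>A. d q s y * f (x + (real s - real p) / N))"
      using at unfolding 1 2 .
  qed
  also have "\<dots> = (\<Sum>s\<in>A. (\<Sum>q\<in>A. c p q y * d q s y) * f (x + (real s - real p) / N))"
    unfolding sum_distrib_left sum_distrib_right by (subst sum.swap) (simp add: mult.assoc)
  also have "\<dots> = (\<Sum>s\<in>A. if p = s then f (x + (real s - real p) / N) else 0)"
    using p by (intro sum.cong refl) (simp add: cd)
  also have "\<dots> = f x" using p finite_A by simp
  finally show ?case .
qed

lemma cell_op_bounded_bijective:
  assumes c: "\<And>p q. continuous_on UNIV (c p q)" "\<And>p q y. norm (c p q y) \<le> C"
    and d: "\<And>p q. continuous_on UNIV (d p q)" "\<And>p q y. norm (d p q y) \<le> D"
    and cd: "\<And>p s y. p \<in> A \<Longrightarrow> s \<in> A \<Longrightarrow> (\<Sum>q\<in>A. c p q y * d q s y) = of_bool (p = s)"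
    and dc: "\<And>p s y. p \<in> A \<Longrightarrow> s \<in> A \<Longrightarrow> (\<Sum>q\<in>A. d p q y * c q s y) = of_bool (p = s)"
  shows "L2_bounded_operator S (cell_op N A c)" "L2_bijective S (cell_op N A c)"
proof -
  let ?U = "cell_op N A c" and ?V = "cell_op N A d"
  note U = cell_op_bounded[where c = c, OF c] and V = cell_op_bounded[where c = d, OF d]
  show "L2_bounded_operator S ?U"
    unfolding L2_bounded_operator_def using U
    by (auto simp: ae_eq_def cell_op_add cell_op_scale)
  have "ae_eq S f g" if f: "f \<in> L2 S" and g: "g \<in> L2 S" and eq: "ae_eq S (?U f) (?U g)" for f g
  proof -
    \<comment> \<open>On representatives, \<open>?V\<close> is known to respect null functions only
      through its norm bound. Passing to the difference \<open>u\<close> makes \<open>?U u\<close>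
      null, so that \<open>?V (?U u)\<close> has norm 0.\<close>
    define u where "u x = f x - g x" for x
    have u: "u \<in> L2 S" unfolding u_def[abs_def] using f g by (rule L2_diff)
    have "f = (\<lambda>x. u x + g x)" by (simp add: u_def)
    then have "?U f x = ?U u x + ?U g x" for x by (simp add: cell_op_add)
    with eq have "AE x in lebesgue_on S. (norm (?U u x))\<^sup>2 = 0"
      unfolding ae_eq_def by (auto elim: eventually_mono)
    then have "(\<integral>x. (norm (?U u x))\<^sup>2 \<partial>(lebesgue_on S)) = 0"
      by (rule integral_eq_zero_AE)
    then have "L2_norm S (?U u) = 0" by (simp add: L2_norm_def)
    then have "L2_norm S (?V (?U u)) \<le> 0"
      using V(2) U(1)[OF u] by force
    then have "L2_norm S (?V (?U u)) = 0"
      using L2_norm_nonneg by (simp add: order_antisym)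
    with V(1)[OF U(1)[OF u]] have "AE x in lebesgue_on S. ?V (?U u) x = 0"
      by (rule L2_norm_eq_0_imp_AE)
    moreover have "ae_eq S (?V (?U u)) u" using dc by (rule cell_op_inverse)
    ultimately show "ae_eq S f g"
      unfolding ae_eq_def by eventually_elim (simp add: u_def)
  qed
  moreover have "\<exists>f\<in>L2 S. ae_eq S (?U f) g" if "g \<in> L2 S" for g
  proof -
    have "ae_eq S (?U (?V g)) g" using cd by (rule cell_op_inverse)
    with V(1)[OF that] show ?thesis by blast
  qed
  ultimately show "L2_bijective S ?U" unfolding L2_bijective_def by blast
qed

end

section \<open>Rational end points and common denominators\<close>

text \<open>Stands for having end points in (1/N) times the integers, but is stable under unions and
  refinement and blind to which end points belong to the set. Only cells of the nonnegative
  half-line are tested.\<close>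

definition cell_resolved :: "nat \<Rightarrow> real set \<Rightarrow> bool" where
  "cell_resolved N S \<longleftrightarrow> (\<forall>n. cell N n \<subseteq> S \<or> cell N n \<inter> S = {})"

lemma cell_mult_subset:
  assumes "0 < N" "0 < m"
  shows "cell (N * m) n \<subseteq> cell N (n div m)"
proof
  fix x assume "x \<in> cell (N * m) n"
  then have x: "real n < N * m * x" "N * m * x < real n + 1"
    using assms by (simp_all add: cell_def field_simps)
  have "(n div m) * m \<le> n" "n + 1 \<le> (n div m + 1) * m"
    using assms dividend_less_div_times[of m n] by (simp_all add: algebra_simps)
  then have "real ((n div m) * m) \<le> real n" "real (n + 1) \<le> real ((n div m + 1) * m)"
    by (simp_all only: of_nat_le_iff)
  then have "real (n div m) * m \<le> real n" "real n + 1 \<le> (real (n div m) + 1) * m"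
    by (simp_all add: distrib_right)
  with x have "real (n div m) * m < N * x * m" "N * x * m < (real (n div m) + 1) * m"
    by (simp_all add: mult.assoc mult.commute mult.left_commute)
  then have "real (n div m) < N * x" "N * x < real (n div m) + 1"
    using assms by simp_all
  then show "x \<in> cell N (n div m)"
    using assms by (simp add: cell_def field_simps)
qed

lemma cell_resolved_mult:
  assumes "cell_resolved N S" "0 < N" "0 < m"
  shows "cell_resolved (N * m) S"
  unfolding cell_resolved_def
proof
  fix n
  show "cell (N * m) n \<subseteq> S \<or> cell (N * m) n \<inter> S = {}"
    using cell_mult_subset[OF assms(2,3), of n] assms(1) unfolding cell_resolved_def by blast
qed

text \<open>Resolutions survive refinement, so the product of two denominators serves both
  sets.\<close>

lemma common_cell_resolution:
  assumes "finite I" "\<And>i. i \<in> I \<Longrightarrow> \<exists>N>0. cell_resolved N (S i)"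
  shows "\<exists>N>0. \<forall>i\<in>I. cell_resolved N (S i)"
  using assms
proof (induction I rule: finite_induct)
  case empty
  then show ?case by auto
next
  case (insert i I)
  then obtain N M where N: "N > 0" "\<forall>i\<in>I. cell_resolved N (S i)"
    and M: "M > 0" "cell_resolved M (S i)"
    by (metis insertCI)
  have "cell_resolved (N * M) (S i')" if "i' \<in> insert i I" for i'
    using that N M cell_resolved_mult[of N "S i'" M] cell_resolved_mult[of M "S i'" N]
    by (auto simp: mult.commute)
  then show ?case using N M by (intro exI[of _ "N * M"]) auto
qed

text \<open>Multiplied by the common denominator the end points become integers, and no integer lies
  strictly between \<open>k\<close> and \<open>k + 1\<close>; an open cell is therefore never
  cut.\<close>

lemma rational_interval_resolution:
  assumes "rational_interval J"
  shows "\<exists>N>0. cell_resolved N J"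
proof -
  obtain a b where ab: "a \<in> \<rat>" "b \<in> \<rat>"
    and J: "J = {a..b} \<or> J = {a..<b} \<or> J = {a<..b} \<or> J = {a<..<b}"
    using assms by (auto simp: rational_interval_def)
  obtain i j :: int and n m :: nat where a: "a = of_int i / n" "n \<noteq> 0" and b: "b = of_int j / m" "m \<noteq> 0"
    using ab by (auto simp: Rats_eq_int_div_nat)
  define N where "N = n * m"
  have N: "N > 0" using a b by (simp add: N_def)
  have a': "a = of_int (i * m) / N" and b': "b = of_int (j * n) / N"
    using a b by (simp_all add: N_def field_simps)
  have "cell N k \<subseteq> J \<or> cell N k \<inter> J = {}" for k
  proof (cases "i * m \<le> k \<and> k + 1 \<le> j * n")
    case True
    then have "real_of_int (i * m) \<le> real k" "real k + 1 \<le> real_of_int (j * n)" by linarith+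
    then have "a \<le> real k / N" "(real k + 1) / N \<le> b"
      unfolding a' b' using N by (intro divide_right_mono; simp)+
    then have "cell N k \<subseteq> {a<..<b}" by (auto simp: cell_def)
    then show ?thesis using J by auto
  next
    case False
    then have "k + 1 \<le> i * m \<or> j * n \<le> k" by linarith
    then have "real k + 1 \<le> real_of_int (i * m) \<or> real_of_int (j * n) \<le> real k" by linarith
    then have "(real k + 1) / N \<le> a \<or> b \<le> real k / N"
      unfolding a' b' using N by (auto intro: divide_right_mono)
    then have "cell N k \<inter> {a..b} = {}" by (auto simp: cell_def)
    then show ?thesis using J by auto
  qed
  then show ?thesis using N by (auto simp: cell_resolved_def)
qed

lemma finite_union_resolution:
  assumes "finite_union_rational_intervals S"
  shows "\<exists>N>0. cell_resolved N S"
proof -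
  obtain \<J> where J: "finite \<J>" "\<forall>J\<in>\<J>. rational_interval J" "S = \<Union>\<J>"
    using assms by (auto simp: finite_union_rational_intervals_def)
  then obtain N where N: "N > 0" "\<forall>J\<in>\<J>. cell_resolved N J"
    using common_cell_resolution[of \<J> "\<lambda>J. J"] rational_interval_resolution by auto
  have "cell N n \<subseteq> S \<or> cell N n \<inter> S = {}" for n
  proof (cases "\<exists>J\<in>\<J>. cell N n \<subseteq> J")
    case True
    then show ?thesis using J(3) by blast
  next
    case False
    then have "\<forall>J\<in>\<J>. cell N n \<inter> J = {}"
      using N(2) unfolding cell_resolved_def by blast
    then show ?thesis using J(3) by blast
  qed
  with N(1) show ?thesis unfolding cell_resolved_def by blast
qed

lemma rational_interval_lmeasurable:
  "rational_interval J \<Longrightarrow> J \<in> lmeasurable"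
  by (auto simp: rational_interval_def intro: bounded_set_imp_lmeasurable)

lemma finite_union_lmeasurable:
  "finite_union_rational_intervals S \<Longrightarrow> S \<in> lmeasurable"
  unfolding finite_union_rational_intervals_def
  using rational_interval_lmeasurable by (auto intro: fmeasurable.finite_Union)

lemma unit_interval_minus_cells:
  assumes "0 < N"
  shows "negligible ({0..<1} - (\<Union>n<N. cell N n))"
proof (rule negligible_subset)
  show "negligible ((\<lambda>i. real i / N) ` {..N})"
    by (intro negligible_finite) auto
  show "{0..<1} - (\<Union>n<N. cell N n) \<subseteq> (\<lambda>i. real i / N) ` {..N}"
  proof
    fix x assume x: "x \<in> {0..<1} - (\<Union>n<N. cell N n)"
    define n where "n = nat \<lfloor>N * x\<rfloor>"
    have n: "real n \<le> N * x" "N * x < real n + 1"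
      using x by (auto simp: n_def)
    moreover have "real n < N"
    proof -
      have "real N * x < real N * 1" using x assms by (intro mult_strict_left_mono) auto
      then show ?thesis using n by simp
    qed
    moreover have "x \<notin> cell N n" using x \<open>real n < N\<close> by auto
    ultimately have "x = real n / N"
      using assms by (auto simp: cell_def field_simps)
    with \<open>real n < N\<close> show "x \<in> (\<lambda>i. real i / N) ` {..N}" by auto
  qed
qed

section \<open>The orthonormal basis of exponentials on cells\<close>

text \<open>The factor \<open>sqrt N\<close> normalises on a cell of length 1/N. The phase may be
  written in \<open>x\<close> instead of \<open>x - p / N\<close>, since the two differ by the
  integer multiple j p of a full turn.\<close>

definition cell_exp :: "nat \<Rightarrow> nat \<Rightarrow> int \<Rightarrow> real \<Rightarrow> complex" where
  "cell_exp N p j x = of_real (sqrt N) * (indicator (cell N p) x * cis (of_int j * (2 * pi * real N) * x))"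

text \<open>For nonzero \<open>j\<close> the antiderivative takes the same value at both ends of the
  cell, a whole number of periods apart.\<close>

lemma integral_cis_cell:
  assumes N: "0 < N"
  shows "(\<integral>x. indicator (cell N p) x *\<^sub>R cis (of_int j * (2 * pi * real N) * x) \<partial>lebesgue)
    = (if j = 0 then 1 / of_nat N else 0)"
proof -
  define a b where "a = real p / N" and "b = (real p + 1) / N"
  have ab: "a \<le> b" using N by (simp add: a_def b_def divide_right_mono)
  let ?f = "\<lambda>x. cis (of_int j * (2 * pi * real N) * x)"
  have "?f \<in> borel_measurable lborel"
    by (auto intro!: borel_measurable_continuous_onI continuous_intros)
  then have meas: "(\<lambda>x. indicator B x *\<^sub>R ?f x) \<in> borel_measurable lborel" if "B \<in> sets borel" for B
    using that by (intro borel_measurable_scaleR borel_measurable_indicator) auto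
  define F where "F x = (if j = 0 then of_real x
    else ?f x / (\<i> * of_real (of_int j * (2 * pi * real N))))" for x
  have "((\<lambda>x. F x) has_vector_derivative ?f x) (at x within {a..b})" for x
  proof (cases "j = 0")
    case True
    have "(of_real has_vector_derivative (1::complex)) (at x within {a..b})"
      using has_vector_derivative_of_real[OF DERIV_ident] by simp
    then show ?thesis using True by (simp add: F_def[abs_def])
  next
    case False
    define w where "w = of_int j * (2 * pi * real N)"
    have w: "w \<noteq> 0" using False N by (simp add: w_def)
    have "((\<lambda>x. exp (of_real x * (\<i> * of_real w)) / (\<i> * of_real w)) has_vector_derivative
        exp (of_real x * (\<i> * of_real w))) (at x within {a..b})"
      using w by (intro has_vector_derivative_real_field) (auto intro!: derivative_eq_intros)
    moreover have "cis (w * x) = exp (of_real x * (\<i> * of_real w))" for x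
      by (simp add: cis_conv_exp mult_ac)
    ultimately show ?thesis using False by (simp add: F_def[abs_def] flip: w_def)
  qed
  moreover have "continuous_on {a..b} ?f" by (intro continuous_intros)
  ultimately have "(\<integral>x. indicator {a..b} x *\<^sub>R ?f x \<partial>lborel) = F b - F a"
    using ab by (intro integral_FTC_Icc) auto
  moreover have "(\<integral>x. indicator (cell N p) x *\<^sub>R ?f x \<partial>lebesgue)
      = (\<integral>x. indicator (cell N p) x *\<^sub>R ?f x \<partial>lborel)"
    by (intro integral_completion meas) simp
  moreover have "\<dots> = (\<integral>x. indicator {a..b} x *\<^sub>R ?f x \<partial>lborel)"
  proof (rule integral_cong_AE)
    have "AE x in lborel. x \<noteq> a" "AE x in lborel. x \<noteq> b" by (rule AE_lborel_singleton)+
    then show "AE x in lborel. indicator (cell N p) x *\<^sub>R ?f x = indicator {a..b} x *\<^sub>R ?f x"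
      by eventually_elim (auto simp: cell_def a_def b_def indicator_def)
  qed (rule meas, simp)+
  moreover have "F b - F a = (if j = 0 then 1 / of_nat N else 0)"
  proof (cases "j = 0")
    case True
    then show ?thesis by (simp add: F_def a_def b_def add_divide_distrib)
  next
    case False
    have "of_int j * (2 * pi * real N) * a = 2 * pi * of_int (j * p)"
      "of_int j * (2 * pi * real N) * b = 2 * pi * of_int (j * (p + 1))"
      using N by (simp_all add: a_def b_def field_simps)
    then have "?f a = 1" "?f b = 1" by (simp_all only: cis_multiple_2pi Ints_of_int)
    then show ?thesis using False by (simp add: F_def)
  qed
  ultimately show ?thesis by simp
qed

context cell_union
begin

lemma cell_exp_measurable: "cell_exp N p j \<in> borel_measurable (lebesgue_on S)"
proof -
  have "cell_exp N p j \<in> borel_measurable borel"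
    unfolding cell_exp_def
    by (intro borel_measurable_times borel_measurable_const borel_measurable_indicator
        borel_measurable_continuous_onI continuous_intros) simp
  then show ?thesis
    by (intro measurable_restrict_space1 measurable_completion) simp
qed

lemma cell_exp_L2: "cell_exp N p j \<in> L2 S"
proof (rule L2_bound(1)[OF cell_exp_measurable])
  show "integrable (lebesgue_on S) (\<lambda>x. real N)"
    using finite_measure_S by (simp add: finite_measure.integrable_const)
  show "(norm (cell_exp N p j x))\<^sup>2 \<le> real N" for x
    by (simp add: cell_exp_def norm_mult power_mult_distrib indicator_def)
qed

lemma cell_exp_inner:
  assumes p: "p \<in> A"
  shows "L2_inner S (cell_exp N p j) (cell_exp N q i) = of_bool (p = q \<and> j = i)"
proof (cases "p = q")
  case True
  have "cell_exp N p j x * cnj (cell_exp N p i x)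
      = of_nat N * (indicator (cell N p) x *\<^sub>R cis (of_int (j - i) * (2 * pi * real N) * x))" for x
  proof -
    have "of_real (sqrt N) * of_real (sqrt N) = (of_nat N :: complex)"
      by (simp flip: of_real_mult)
    moreover have "cis (of_int j * (2 * pi * real N) * x) * cis (- (of_int i * (2 * pi * real N) * x))
      = cis (of_int (j - i) * (2 * pi * real N) * x)"
      by (simp add: cis_mult algebra_simps)
    moreover have "cell_exp N p j x * cnj (cell_exp N p i x)
      = (of_real (sqrt N) * of_real (sqrt N)) * (indicator (cell N p) x *\<^sub>R
          (cis (of_int j * (2 * pi * real N) * x) * cis (- (of_int i * (2 * pi * real N) * x))))"
      by (simp add: cell_exp_def indicator_def cis_cnj)
    ultimately show ?thesis by (simp only:)
  qed
  then have "L2_inner S (cell_exp N p j) (cell_exp N p i)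
      = (\<integral>x. indicator S x *\<^sub>R (of_nat N * (indicator (cell N p) x *\<^sub>R
          cis (of_int (j - i) * (2 * pi * real N) * x))) \<partial>lebesgue)"
    unfolding L2_inner_def by (subst integral_restrict_space) auto
  also have "\<dots> = (\<integral>x. of_nat N * (indicator (cell N p) x *\<^sub>R
          cis (of_int (j - i) * (2 * pi * real N) * x)) \<partial>lebesgue)"
    using cell_subset[OF p] by (intro Bochner_Integration.integral_cong) (auto simp: indicator_def)
  also have "\<dots> = of_nat N * (if j - i = 0 then 1 / of_nat N else 0)"
    unfolding integral_mult_right_zero integral_cis_cell[OF N_pos] ..
  finally show ?thesis using True N_pos by simp
next
  case False
  have "cell_exp N p j x * cnj (cell_exp N q i x) = 0" for x
    using False cell_unique[of x N p q] by (auto simp: cell_exp_def indicator_def)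
  then have "L2_inner S (cell_exp N p j) (cell_exp N q i) = 0"
    unfolding L2_inner_def by (simp only: integral_zero)
  then show ?thesis using False by simp
qed

lemma cell_exp_approx:
  assumes g: "g \<in> L2 S" and "0 < \<epsilon>"
  obtains F c where "\<And>p. finite (F p)"
    "L2_norm S (\<lambda>x. g x - (\<Sum>p\<in>A. \<Sum>j\<in>F p. c p j * cell_exp N p j x)) < \<epsilon>"
proof -
  obtain f M where f: "f \<in> borel_measurable lebesgue" "\<And>x. norm (f x) \<le> M"
    and gf: "(\<lambda>x. g x - f x) \<in> L2 S" "L2_norm S (\<lambda>x. g x - f x) < \<epsilon> / 2"
    using L2_bounded_approx[OF g, of "\<epsilon> / 2"] \<open>0 < \<epsilon>\<close> by auto
  obtain P where P: "\<And>p. trig_polynomial (2 * pi * real N) (P p)"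
    and fP: "(\<lambda>x. f x - (\<Sum>p\<in>A. indicator (cell N p) x * P p x)) \<in> L2 S"
      "L2_norm S (\<lambda>x. f x - (\<Sum>p\<in>A. indicator (cell N p) x * P p x)) < \<epsilon> / 2"
    using L2_trig_approx[OF f, of "\<epsilon> / 2"] \<open>0 < \<epsilon>\<close> by auto
  have "\<forall>p. \<exists>F c. finite F \<and> P p = (\<lambda>x. \<Sum>j\<in>F. c j * cis (of_int j * (2 * pi * real N) * x))"
    using trig_polynomial_eq_sum[OF P] by (rule allI)
  from choice[OF this] obtain F where
    "\<forall>p. \<exists>c. finite (F p) \<and> P p = (\<lambda>x. \<Sum>j\<in>F p. c j * cis (of_int j * (2 * pi * real N) * x))"
    by (rule exE)
  from choice[OF this] obtain c where F: "\<And>p. finite (F p)"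
    and Pc: "\<And>p. P p = (\<lambda>x. \<Sum>j\<in>F p. c p j * cis (of_int j * (2 * pi * real N) * x))"
    by blast
  define Q where "Q x = (\<Sum>p\<in>A. indicator (cell N p) x * P p x)" for x
  have Q_eq: "(\<Sum>p\<in>A. \<Sum>j\<in>F p. (c p j / of_real (sqrt N)) * cell_exp N p j x) = Q x" for x
    using N_pos by (simp add: Q_def Pc cell_exp_def sum_distrib_left mult.left_commute)
  have "(L2_norm S (\<lambda>x. (g x - f x) + (f x - Q x)))\<^sup>2
      \<le> 2 * ((L2_norm S (\<lambda>x. g x - f x))\<^sup>2 + (L2_norm S (\<lambda>x. f x - Q x))\<^sup>2)"
    using gf(1) fP(1) unfolding Q_def by (rule L2_add)
  \<comment> \<open>The halves of \<open>\<epsilon>\<close> compensate exactly for the factor 2 in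
    \<open>L2_add\<close>.\<close>
  also have "\<dots> < 2 * ((\<epsilon> / 2)\<^sup>2 + (\<epsilon> / 2)\<^sup>2)"
    using gf(2) fP(2) L2_norm_nonneg unfolding Q_def
    by (intro mult_strict_left_mono add_strict_mono power_strict_mono) auto
  also have "\<dots> = \<epsilon>\<^sup>2" by (simp add: power2_eq_square)
  finally have "L2_norm S (\<lambda>x. g x - Q x) < \<epsilon>"
    using \<open>0 < \<epsilon>\<close> by (simp add: power2_less_imp_less)
  then show ?thesis
    using that[of F "\<lambda>p j. c p j / of_real (sqrt N)"] F by (simp only: Q_eq)
qed

text \<open>A Riesz basis shares its index set with the orthonormal basis it comes from, so the cell
  exponentials are reindexed by an arbitrary \<open>I\<close>, later the set of labelled
  frequencies.\<close>

lemma cell_exp_orthonormal_basis: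
  assumes \<phi>: "bij_betw \<phi> I (A \<times> UNIV)"
  shows "L2_orthonormal_basis S I (\<lambda>i. cell_exp N (fst (\<phi> i)) (snd (\<phi> i)))"
  unfolding L2_orthonormal_basis_def
proof (intro conjI ballI)
  show "cell_exp N (fst (\<phi> i)) (snd (\<phi> i)) \<in> L2 S" for i by (rule cell_exp_L2)
  fix i j assume ij: "i \<in> I" "j \<in> I"
  then have "fst (\<phi> i) \<in> A" using bij_betwE[OF \<phi>] by (auto simp: mem_Times_iff)
  moreover have "\<phi> i = \<phi> j \<longleftrightarrow> i = j"
    using bij_betw_imp_inj_on[OF \<phi>] ij by (auto simp: inj_on_eq_iff)
  ultimately show "L2_inner S (cell_exp N (fst (\<phi> i)) (snd (\<phi> i))) (cell_exp N (fst (\<phi> j)) (snd (\<phi> j)))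
      = (if i = j then 1 else 0)"
    by (simp add: cell_exp_inner prod_eq_iff)
next
  show "L2_complete S I (\<lambda>i. cell_exp N (fst (\<phi> i)) (snd (\<phi> i)))"
    unfolding L2_complete_def
  proof (intro ballI allI impI)
    fix g and \<epsilon> :: real assume "g \<in> L2 S" "0 < \<epsilon>"
    then obtain F c where F: "\<And>p. finite (F p)"
      and less: "L2_norm S (\<lambda>x. g x - (\<Sum>p\<in>A. \<Sum>j\<in>F p. c p j * cell_exp N p j x)) < \<epsilon>"
      by (rule cell_exp_approx) blast
    define G where "G = {i \<in> I. \<phi> i \<in> Sigma A F}"
    have bij: "bij_betw \<phi> G (Sigma A F)"
    proof (rule bij_betw_subset[OF \<phi>])
      have "Sigma A F \<subseteq> \<phi> ` I" using bij_betw_imp_surj_on[OF \<phi>] by auto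
      moreover have "\<phi> ` {i \<in> I. \<phi> i \<in> Y} = Y" if "Y \<subseteq> \<phi> ` I" for Y
        using that by blast
      ultimately show "\<phi> ` G = Sigma A F" unfolding G_def by (simp only:)
    qed (auto simp: G_def)
    have "finite G"
      using bij_betw_finite[OF bij] F finite_A by auto
    moreover have "G \<subseteq> I" by (auto simp: G_def)
    moreover have "(\<Sum>p\<in>A. \<Sum>j\<in>F p. c p j * cell_exp N p j x)
        = (\<Sum>i\<in>G. c (fst (\<phi> i)) (snd (\<phi> i)) * cell_exp N (fst (\<phi> i)) (snd (\<phi> i)) x)" for x
      using F finite_A sum.reindex_bij_betw[OF bij, of "\<lambda>i. c (fst i) (snd i) * cell_exp N (fst i) (snd i) x"]
      by (simp add: sum.Sigma case_prod_beta)
    ultimately show "\<exists>G c. finite G \<and> G \<subseteq> I \<and>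
        L2_norm S (\<lambda>x. g x - (\<Sum>i\<in>G. c i * cell_exp N (fst (\<phi> i)) (snd (\<phi> i)) x)) < \<epsilon>"
      using less by (intro exI[of _ G] exI[of _ "\<lambda>i. c (fst (\<phi> i)) (snd (\<phi> i))"]) simp
  qed
qed

end

section \<open>The windowed exponentials as images of the basis, and the choice of
  frequencies\<close>

lemma windowed_exp_eq_cis: "windowed_exp S \<xi> x = indicator S x * cis (2 * pi * \<xi> * x)"
  by (simp add: windowed_exp_def cis_conv_exp mult_ac)

context cell_union
begin

text \<open>The exponentials with frequencies \<open>r + N \<int>\<close>, \<open>r \<in> R\<close>, are images of the basis functions
  \<open>cell_exp\<close> living on the cell \<open>\<sigma> r\<close>, under the operator with the matrix of the finite
  Fourier block, twisted by \<open>cis (2 * pi * r * y)\<close>.\<close>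

lemma riesz_basis_of_invertible_block:
  fixes W :: "nat \<Rightarrow> real set" and \<kappa> :: "nat \<Rightarrow> nat"
  defines "R \<equiv> {r. r < N \<and> \<kappa> r \<noteq> 0}"
  assumes A_less: "A \<subseteq> {..<N}"
    and B: "mutually_inverse A R
      (\<lambda>n r. of_bool (cell N n \<subseteq> W (\<kappa> r)) * cis (2 * pi * real n / real N) ^ r) B"
    and W: "\<And>r. r \<in> R \<Longrightarrow> cell_resolved N (W (\<kappa> r))"
    and I: "I = {(k, \<xi>). k \<noteq> 0 \<and> \<kappa> (nat (\<xi> mod int N)) = k}"
  shows "L2_riesz_basis S I (\<lambda>(k, \<xi>). windowed_exp (W k) (real_of_int \<xi>))"
proof -
  define M where "M n r = of_bool (cell N n \<subseteq> W (\<kappa> r)) * cis (2 * pi * real n / real N) ^ r"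
    for n r
  have inv: "mutually_inverse A R M B" using B by (simp add: M_def[abs_def])
  have fin_R: "finite R" by (simp add: R_def)
  obtain \<sigma> where \<sigma>: "bij_betw \<sigma> R A"
    using finite_same_card_bij[OF fin_R finite_A] mutually_inverse_card_eq[OF inv] by auto
  define \<tau> where "\<tau> = inv_into R \<sigma>"
  have \<tau>: "bij_betw \<tau> A R" unfolding \<tau>_def using \<sigma> by (rule bij_betw_inv_into)
  have \<tau>\<sigma>: "\<tau> (\<sigma> r) = r" if "r \<in> R" for r
    unfolding \<tau>_def using \<sigma> that by (rule bij_betw_inv_into_left)
  have \<sigma>\<tau>: "\<sigma> (\<tau> p) = p" if "p \<in> A" for p
    unfolding \<tau>_def using \<sigma> that by (rule bij_betw_inv_into_right)
  have \<tau>R: "\<tau> p \<in> R" if "p \<in> A" for p using bij_betwE[OF \<tau>] that by blast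
  have \<sigma>A: "\<sigma> r \<in> A" if "r \<in> R" for r using bij_betwE[OF \<sigma>] that by blast
  define res where "res \<xi> = nat (\<xi> mod int N)" for \<xi>
  have res_less: "res \<xi> < N" for \<xi>
    using N_pos by (simp add: res_def nat_less_iff)
  have I_iff: "(k, \<xi>) \<in> I \<longleftrightarrow> res \<xi> \<in> R \<and> k = \<kappa> (res \<xi>)" for k \<xi>
    using res_less[of \<xi>] by (auto simp: I R_def res_def)
  have res_div: "int (res \<xi>) + int N * (\<xi> div int N) = \<xi>" for \<xi>
    using N_pos by (simp add: res_def)
  have split: "res (int r + int N * j) = r" "(int r + int N * j) div int N = j" if "r < N" for r j
    using that N_pos by (simp_all add: res_def)

  \<comment> \<open>The frequency r + N j is assigned to the \<open>j\<close>-th exponential on the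
    cell \<open>\<sigma> r\<close>; the label \<open>k\<close> is determined by the residue.\<close>
  define \<phi> where "\<phi> = (\<lambda>(k::nat, \<xi>). (\<sigma> (res \<xi>), \<xi> div int N))"
  have \<phi>: "bij_betw \<phi> I (A \<times> UNIV)"
  proof (rule bij_betw_byWitness[where f' = "\<lambda>(p, j). (\<kappa> (\<tau> p), int (\<tau> p) + int N * j)"])
    show "\<forall>i\<in>I. (\<lambda>(p, j). (\<kappa> (\<tau> p), int (\<tau> p) + int N * j)) (\<phi> i) = i"
      by (auto simp: \<phi>_def I_iff \<tau>\<sigma> res_div)
    have less: "\<tau> p < N" if "p \<in> A" for p using \<tau>R[OF that] by (simp add: R_def)
    show "\<forall>i\<in>A \<times> UNIV. \<phi> ((\<lambda>(p, j). (\<kappa> (\<tau> p), int (\<tau> p) + int N * j)) i) = i"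
      by (auto simp: \<phi>_def split less \<sigma>\<tau>)
    show "\<phi> ` I \<subseteq> A \<times> UNIV" by (auto simp: \<phi>_def I_iff \<sigma>A)
    show "(\<lambda>(p, j). (\<kappa> (\<tau> p), int (\<tau> p) + int N * j)) ` (A \<times> UNIV) \<subseteq> I"
      by (auto simp: I_iff split less \<tau>R)
  qed
  define e where "e i = cell_exp N (fst (\<phi> i)) (snd (\<phi> i))" for i
  have basis: "L2_orthonormal_basis S I e"
    unfolding e_def[abs_def] using \<phi> by (rule cell_exp_orthonormal_basis)

  \<comment> \<open>Column \<open>q\<close> belongs to the residue \<open>\<tau> q\<close> matched
    with the cell \<open>q\<close>; dividing by \<open>sqrt N\<close> cancels the normalisation of
    \<open>cell_exp\<close>.\<close>
  define c where "c p q y = M p (\<tau> q) * cis (2 * pi * \<tau> q * y) / of_real (sqrt N)" for p q y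
  \<comment> \<open>Setting the entries to 0 outside \<open>A\<close> gives a bound valid for all
    indices, as the boundedness lemma demands.\<close>
  define d where "d p q y = (if p \<in> A \<and> q \<in> A then
      of_real (sqrt N) * cis (- (2 * pi * \<tau> p * y)) * B (\<tau> p) q else 0)" for p q y
  have sqrt_N: "of_real (sqrt N) \<noteq> (0::complex)" using N_pos by simp
  have MB: "(\<Sum>q\<in>A. M p (\<tau> q) * B (\<tau> q) s) = of_bool (p = s)" if "p \<in> A" "s \<in> A" for p s
    using inv that sum.reindex_bij_betw[OF \<tau>, of "\<lambda>r. M p r * B r s"]
    by (simp add: mutually_inverse_def)
  have BM: "(\<Sum>q\<in>A. B (\<tau> p) q * M q (\<tau> s)) = of_bool (p = s)" if "p \<in> A" "s \<in> A" for p s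
    using inv that \<tau>R bij_betw_imp_inj_on[OF \<tau>]
    by (simp add: mutually_inverse_def inj_on_eq_iff)
  have c_bound: "norm (c p q y) \<le> 1 / sqrt N" for p q y
    by (auto simp: c_def M_def norm_mult norm_divide norm_power)
  have d_bound: "norm (d p q y) \<le> sqrt N * (\<Sum>i\<in>A \<times> A. norm (B (\<tau> (fst i)) (snd i)))" for p q y
  proof (cases "p \<in> A \<and> q \<in> A")
    case True
    then have "norm (B (\<tau> p) q) \<le> (\<Sum>i\<in>A \<times> A. norm (B (\<tau> (fst i)) (snd i)))"
      using member_le_sum[of "(p, q)" "A \<times> A" "\<lambda>i. norm (B (\<tau> (fst i)) (snd i))"] finite_A
      by simp
    then show ?thesis using True by (simp add: d_def norm_mult mult_left_mono)
  next
    case False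
    then show ?thesis by (auto simp: d_def intro!: mult_nonneg_nonneg sum_nonneg)
  qed
  have c_cont: "continuous_on UNIV (c p q)" for p q
    unfolding c_def using sqrt_N by (intro continuous_intros) auto
  have d_cont: "continuous_on UNIV (d p q)" for p q
    unfolding d_def by (cases "p \<in> A \<and> q \<in> A") (auto intro!: continuous_intros)
  have cd: "(\<Sum>q\<in>A. c p q y * d q s y) = of_bool (p = s)" if "p \<in> A" "s \<in> A" for p s y
  proof -
    have "(\<Sum>q\<in>A. c p q y * d q s y) = (\<Sum>q\<in>A. M p (\<tau> q) * B (\<tau> q) s)"
    proof (rule sum.cong[OF refl])
      fix q assume q: "q \<in> A"
      have "c p q y * d q s y = M p (\<tau> q) * B (\<tau> q) s *
          (cis (2 * pi * \<tau> q * y) * cis (- (2 * pi * \<tau> q * y)))"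
        using q that sqrt_N by (simp add: c_def d_def del: cis_mult)
      then show "c p q y * d q s y = M p (\<tau> q) * B (\<tau> q) s" by (simp add: cis_mult)
    qed
    then show ?thesis using MB[OF that] by simp
  qed
  have dc: "(\<Sum>q\<in>A. d p q y * c q s y) = of_bool (p = s)" if "p \<in> A" "s \<in> A" for p s y
  proof -
    \<comment> \<open>The phases do not depend on \<open>q\<close> and leave the sum; they cancel
      for \<open>p = s\<close>, the only case in which the remaining sum is nonzero.\<close>
    have "(\<Sum>q\<in>A. d p q y * c q s y) = (\<Sum>q\<in>A. B (\<tau> p) q * M q (\<tau> s)) *
        (cis (- (2 * pi * \<tau> p * y)) * cis (2 * pi * \<tau> s * y))"
      unfolding sum_distrib_right
    proof (rule sum.cong[OF refl])
      fix q assume q: "q \<in> A"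
      show "d p q y * c q s y = B (\<tau> p) q * M q (\<tau> s) *
          (cis (- (2 * pi * \<tau> p * y)) * cis (2 * pi * \<tau> s * y))"
        using q that sqrt_N by (simp add: c_def d_def del: cis_mult)
    qed
    then show ?thesis using BM[OF that] by (auto simp: cis_mult)
  qed
  note U = cell_op_bounded_bijective[where c = c and d = d,
      OF c_cont c_bound d_cont d_bound cd dc]

  have image: "ae_eq S (windowed_exp (W k) (of_int \<xi>)) (cell_op N A c (e (k, \<xi>)))"
    if "(k, \<xi>) \<in> I" for k \<xi>
    unfolding ae_eq_def using AE_cell
  proof eventually_elim
    case (elim x)
    then obtain p where p: "p \<in> A" "x \<in> cell N p" by blast
    define r where "r = res \<xi>"
    define j where "j = \<xi> div int N"
    have r: "r \<in> R" "k = \<kappa> r" using that by (auto simp: I_iff r_def)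
    have e: "e (k, \<xi>) = cell_exp N (\<sigma> r) j"
      by (simp add: e_def \<phi>_def r_def j_def)
    define y where "y = x - real p / N"
    have "cell_op N A c (e (k, \<xi>)) x
        = (\<Sum>q\<in>A. c p q y * e (k, \<xi>) (x + (real q - real p) / N))"
      using p by (simp add: cell_op_at y_def)
    \<comment> \<open>The basis function lives on the single cell \<open>\<sigma> r\<close>, so the
      operator picks out one column of its matrix.\<close>
    also have "\<dots> = (\<Sum>q\<in>A. if q = \<sigma> r then M p r * cis (2 * pi * r * y) *
        cis (of_int j * (2 * pi * real N) * (x + (real q - real p) / N)) else 0)"
    proof (rule sum.cong[OF refl])
      fix q assume q: "q \<in> A"
      have "x + (real q - real p) / N \<in> cell N q" using p by (simp add: cell_shift_iff)
      then have "x + (real q - real p) / N \<in> cell N (\<sigma> r) \<longleftrightarrow> q = \<sigma> r"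
        using cell_unique by blast
      then show "c p q y * e (k, \<xi>) (x + (real q - real p) / N)
          = (if q = \<sigma> r then M p r * cis (2 * pi * r * y) *
              cis (of_int j * (2 * pi * real N) * (x + (real q - real p) / N)) else 0)"
        using sqrt_N \<tau>\<sigma>[OF r(1)]
        by (cases "q = \<sigma> r") (simp_all add: e cell_exp_def c_def)
    qed
    also have "\<dots> = M p r * cis (2 * pi * r * y) *
        cis (of_int j * (2 * pi * real N) * (x + (real (\<sigma> r) - real p) / N))"
      using finite_A \<sigma>A[OF r(1)] by simp
    \<comment> \<open>A shift by a multiple of 1/N changes the phase of frequency N j by full turns
      only, so no trace of the matching \<sigma> remains.\<close>
    also have "of_int j * (2 * pi * real N) * (x + (real (\<sigma> r) - real p) / N)
        = 2 * pi * of_int j * real N * x + 2 * pi * of_int (j * (int (\<sigma> r) - int p))"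
      using N_pos by (simp add: field_simps)
    also have "cis \<dots> = cis (2 * pi * of_int j * real N * x)"
      by (simp only: cis_mult[symmetric] cis_multiple_2pi[OF Ints_of_int] mult_1_right)
    also have "M p r = indicator (W k) x * cis (real r * (2 * pi * real p / N))"
    proof -
      have "cell N p \<subseteq> W k \<longleftrightarrow> x \<in> W k"
        using W[OF r(1)] p(2) r(2) unfolding cell_resolved_def by blast
      then show ?thesis unfolding M_def Complex.DeMoivre r(2)[symmetric]
        by (auto simp: indicator_def)
    qed
    also have "indicator (W k) x * cis (real r * (2 * pi * real p / N)) * cis (2 * pi * r * y) *
        cis (2 * pi * of_int j * real N * x) = indicator (W k) x * cis (2 * pi * of_int \<xi> * x)"
    proof -
      have "real_of_int \<xi> = real r + real N * of_int j"
        using res_div[of \<xi>] unfolding r_def j_def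
        by (metis of_int_add of_int_mult of_int_of_nat_eq)
      \<comment> \<open>With x = p/N + y, the three phases r p/N, r y and N j x add up to (r + N j)
        x.\<close>
      then have "real r * (2 * pi * real p / N) + 2 * pi * r * y + 2 * pi * of_int j * real N * x
          = 2 * pi * of_int \<xi> * x"
        using N_pos by (simp add: y_def field_simps)
      then show ?thesis by (simp only: mult.assoc cis_mult)
    qed
    finally show ?case by (simp add: windowed_exp_eq_cis)
  qed
  show ?thesis
    unfolding L2_riesz_basis_def using basis U image
    by (intro exI[of _ e] exI[of _ "cell_op N A c"]) auto
qed

end

theorem corollary2:
  fixes K :: nat and S :: "nat \<Rightarrow> real set"
  assumes "1 \<le> K"
    and "\<And>k. k \<in> {1..K} \<Longrightarrow> S k \<subseteq> {0..<1}"
    and "\<And>k. k \<in> {1..K} \<Longrightarrow> finite_union_rational_intervals (S k)"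
  shows "\<exists>\<Lambda> :: nat \<Rightarrow> int set.
           disjoint_family_on \<Lambda> {1..K} \<and>
           L2_riesz_basis (\<Union>k\<in>{1..K}. S k) (SIGMA k:{1..K}. \<Lambda> k)
             (\<lambda>(k, \<xi>). windowed_exp (S k) (real_of_int \<xi>)) \<and>
           ((\<Union>k\<in>{1..K}. S k) = {0..<1} \<longrightarrow> (\<Union>k\<in>{1..K}. \<Lambda> k) = UNIV)"
proof -
  define T where "T = (\<Union>k\<in>{1..K}. S k)"
  obtain N where N: "N > 0" and resolved: "\<And>k. k \<in> {1..K} \<Longrightarrow> cell_resolved N (S k)"
    using common_cell_resolution[of "{1..K}" S] finite_union_resolution assms(3) by auto
  define A where "A k = {n. n < N \<and> cell N n \<subseteq> S k}" for k
  define X where "X = (\<Union>k\<in>{1..K}. A k)"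
  obtain \<kappa> B where \<kappa>: "\<And>r. r < N \<Longrightarrow> \<kappa> r \<le> K"
    and B: "mutually_inverse X {r. r < N \<and> \<kappa> r \<noteq> 0}
           (\<lambda>n r. of_bool (n \<in> A (\<kappa> r)) * cis (2 * pi * real n / real N) ^ r) B"
    using exists_invertible_fourier_block[of K A N] unfolding X_def by (auto simp: A_def)
  have X: "X \<subseteq> {..<N}" by (auto simp: X_def A_def)
  have in_A: "x \<in> cell N n \<Longrightarrow> x \<in> S k \<Longrightarrow> k \<in> {1..K} \<Longrightarrow> n < N \<Longrightarrow> n \<in> A k" for x n k
    using resolved[of k] unfolding cell_resolved_def A_def by blast
  have T_sub: "T \<subseteq> {0..<1}" unfolding T_def using assms(2) by blast
  interpret cell_union T N X
  proof
    show "0 < N" by (rule N)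
    show "finite X" using X finite_subset by blast
    show "T \<in> lmeasurable"
      unfolding T_def using assms(3) finite_union_lmeasurable by (intro fmeasurable.finite_UN) auto
    show "cell N p \<subseteq> T" if "p \<in> X" for p
      using that by (auto simp: X_def A_def T_def)
    have "T - (\<Union>p\<in>X. cell N p) \<subseteq> {0..<1} - (\<Union>n<N. cell N n)"
    proof
      fix x assume x: "x \<in> T - (\<Union>p\<in>X. cell N p)"
      have "x \<notin> cell N n" if n: "n < N" for n
      proof
        assume "x \<in> cell N n"
        moreover obtain k where "k \<in> {1..K}" "x \<in> S k" using x by (auto simp: T_def)
        ultimately have "n \<in> X" using in_A n unfolding X_def by blast
        with x \<open>x \<in> cell N n\<close> show False by blast
      qed
      then show "x \<in> {0..<1} - (\<Union>n<N. cell N n)" using x T_sub by auto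
    qed
    with unit_interval_minus_cells[OF N] show "negligible (T - (\<Union>p\<in>X. cell N p))"
      by (rule negligible_subset)
  qed
  \<comment> \<open>Residues labelled 0 enter none of the sets with index in \<open>{1..K}\<close>;
    disjointness holds because each residue has one label.\<close>
  define \<Lambda> where "\<Lambda> k = {\<xi>. \<kappa> (nat (\<xi> mod int N)) = k}" for k
  have res_less: "nat (\<xi> mod int N) < N" for \<xi>
    using N by (simp add: nat_less_iff)
  have "disjoint_family_on \<Lambda> {1..K}"
    by (auto simp: disjoint_family_on_def \<Lambda>_def)
  moreover have "L2_riesz_basis T (SIGMA k:{1..K}. \<Lambda> k)
      (\<lambda>(k, \<xi>). windowed_exp (S k) (real_of_int \<xi>))"
  proof (rule riesz_basis_of_invertible_block[OF X])
    have "of_bool (cell N n \<subseteq> S k) = (of_bool (n \<in> A k) :: complex)" if "n \<in> X" for n k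
      using that X by (auto simp: A_def)
    then show "mutually_inverse X {r. r < N \<and> \<kappa> r \<noteq> 0}
        (\<lambda>n r. of_bool (cell N n \<subseteq> S (\<kappa> r)) * cis (2 * pi * real n / real N) ^ r) B"
      using B unfolding mutually_inverse_def by (simp cong: sum.cong)
    show "cell_resolved N (S (\<kappa> r))" if "r \<in> {r. r < N \<and> \<kappa> r \<noteq> 0}" for r
      using that \<kappa>[of r] by (intro resolved) auto
    show "(SIGMA k:{1..K}. \<Lambda> k) = {(k, \<xi>). k \<noteq> 0 \<and> \<kappa> (nat (\<xi> mod int N)) = k}"
      using \<kappa>[OF res_less] by (auto simp: \<Lambda>_def)
  qed
  moreover have "(\<Union>k\<in>{1..K}. \<Lambda> k) = UNIV" if "T = {0..<1}"
  proof -
    have "n \<in> X" if n: "n < N" for n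
    proof -
      \<comment> \<open>The midpoint witnesses that the cell meets \<open>T\<close>, and resolution
        then puts the whole cell into some \<open>S k\<close>.\<close>
      define x where "x = (real n + 1 / 2) / N"
      have x: "x \<in> cell N n" using N by (simp add: x_def cell_def divide_strict_right_mono)
      have "0 \<le> x" "x < 1" using n by (auto simp: x_def field_simps)
      then have "x \<in> T" using \<open>T = {0..<1}\<close> by simp
      then show ?thesis using in_A[OF x _ _ n] unfolding T_def X_def by blast
    qed
    then have "X = {..<N}" using X by auto
    \<comment> \<open>With all \<open>N\<close> cells occupied, squareness of the block forces all
      \<open>N\<close> residues to carry a nonzero label.\<close>
    then have "card {r. r < N \<and> \<kappa> r \<noteq> 0} = card {..<N}"
      using mutually_inverse_card_eq[OF B] by simp
    then have "{r. r < N \<and> \<kappa> r \<noteq> 0} = {..<N}"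
      by (intro card_subset_eq) auto
    then have "\<kappa> r \<noteq> 0" if "r < N" for r using that by auto
    then have "\<kappa> (nat (\<xi> mod int N)) \<in> {1..K}" for \<xi>
      using \<kappa>[OF res_less, of \<xi>] res_less[of \<xi>] by (simp add: Suc_le_eq)
    then show ?thesis by (auto simp: \<Lambda>_def)
  qed
  ultimately show ?thesis unfolding T_def by blast
qed


end
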